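(* Let $K$ be a field of positive prime characteristic, let $n$ and $t$ be positive integers with $t+1\leqslant n$, and let $X=(x_{ij})$ be an $n\times n$ symmetric matrix of indeterminates over $K$ (so $x_{ij}=x_{ji}$, and the distinct entries $x_{ij}$, $i\leqslant j$, are algebraically independent). Let $I_{t+1}(X)$ be the ideal of the polynomial ring $K[X]$ generated by the $(t+1)\times(t+1)$ minors of $X$. Then the ring $K[X]/I_{t+1}(X)$ is $F$-regular.
   Context: For $\mathbb{N}$-graded rings finitely generated over a field of positive characteristic, weak $F$-regularity, $F$-regularity and strong $F$-regularity coincide, so no distinction is made among them. *)

theory Defs
  imports "HOL-Library.Poly_Mapping" "HOL-Algebra.QuotRing"
    "Jordan_Normal_Form.Determinant" "Jordan_Normal_Form.DL_Submatrix"
begin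

definition frob_power :: "('a, 'b) ring_scheme \<Rightarrow> 'a set \<Rightarrow> nat \<Rightarrow> 'a set" where
  "frob_power R I q = genideal R ((\<lambda>a. a [^]\<^bsub>R\<^esub> q) ` I)"

definition minimal_prime :: "('a, 'b) ring_scheme \<Rightarrow> 'a set \<Rightarrow> bool" where
  "minimal_prime R P \<longleftrightarrow> primeideal P R \<and>
     (\<forall>Q. primeideal Q R \<and> Q \<subseteq> P \<longrightarrow> Q = P)"

definition ring_circ :: "('a, 'b) ring_scheme \<Rightarrow> 'a set" where
  "ring_circ R = {c \<in> carrier R. \<forall>P. minimal_prime R P \<longrightarrow> c \<notin> P}"

definition tight_closure :: "('a, 'b) ring_scheme \<Rightarrow> nat \<Rightarrow> 'a set \<Rightarrow> 'a set" where
  "tight_closure R p I = {x \<in> carrier R. \<exists>c \<in> ring_circ R. \<exists>e0. \<forall>e\<ge>e0.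
      c \<otimes>\<^bsub>R\<^esub> (x [^]\<^bsub>R\<^esub> (p ^ e)) \<in> frob_power R I (p ^ e)}"

text \<open>Weakly F-regular: every ideal is tightly closed.  (For N-graded finitely generated
  algebras over a field of positive characteristic this coincides with F-regularity
  and strong F-regularity.)\<close>
definition weakly_F_regular :: "('a, 'b) ring_scheme \<Rightarrow> nat \<Rightarrow> bool" where
  "weakly_F_regular R p \<longleftrightarrow> (\<forall>I. ideal I R \<longrightarrow> tight_closure R p I = I)"

type_synonym 'k mpoly = "((nat \<times> nat) \<Rightarrow>\<^sub>0 nat) \<Rightarrow>\<^sub>0 'k"

definition sym_vars :: "nat \<Rightarrow> (nat \<times> nat) set" where
  "sym_vars n = {(i, j). i \<le> j \<and> j < n}"

definition sym_poly_ring :: "nat \<Rightarrow> ('k::comm_ring_1) mpoly ring" where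
  "sym_poly_ring n = \<lparr>carrier = {p :: 'k mpoly. \<forall>m \<in> Poly_Mapping.keys p. Poly_Mapping.keys m \<subseteq> sym_vars n},
     monoid.mult = (*), one = 1, ring.zero = 0, ring.add = (+)\<rparr>"

text \<open>The (i,j) entry of X is x_{min i j, max i j}, so that x_ij = x_ji.\<close>
definition xvar :: "nat \<Rightarrow> nat \<Rightarrow> ('k::comm_ring_1) mpoly" where
  "xvar i j = Poly_Mapping.single (Poly_Mapping.single (min i j, max i j) 1) 1"

definition symX :: "nat \<Rightarrow> ('k::comm_ring_1) mpoly mat" where
  "symX n = mat n n (\<lambda>(i, j). xvar i j)"

definition minors :: "nat \<Rightarrow> nat \<Rightarrow> ('k::comm_ring_1) mpoly set" where
  "minors n r = {det (submatrix (symX n) I J) | I J.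
      I \<subseteq> {..<n} \<and> J \<subseteq> {..<n} \<and> card I = r \<and> card J = r}"

definition det_ideal :: "nat \<Rightarrow> nat \<Rightarrow> ('k::comm_ring_1) mpoly set" where
  "det_ideal n r = genideal (sym_poly_ring n) (minors n r)"

end

theory Submission
  imports Defs "HOL-Library.Product_Lexorder" "HOL-Computational_Algebra.Primes"
begin

text \<open>Let \<open>I\<close> be the ideal of minors of size \<open>t + 1\<close> and \<open>h\<close> its height. The monomials not divisible by the
  diagonal of such a minor stay linearly independent under \<open>x_ij \<mapsto> \<Sum>k<t. y_ki * y_kj\<close>, so \<open>I\<close> is the
  kernel of this map and hence prime. Once the corner \<open>t\<close>-minor \<open>\<mu>\<close> is inverted, \<open>I\<close> is generated by the \<open>h\<close>
  minors bordering it; by pigeonhole, any \<open>g\<close> whose multiple by a power of \<open>\<mu>\<close> lies in the \<open>h * (q - 1)\<close>-th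
  power of these generators yields a Frobenius trace \<open>\<Phi> (g * _)\<close> that descends to the quotient. Two choices of
  \<open>g\<close> suffice. The product of the \<open>h\<close> bordered minors gives traces that send a power of \<open>\<mu>\<close> times any given
  \<open>c \<notin> I\<close> to \<open>\<mu> ^ h\<close>. The product of the minors along all the diagonals parallel to the main one has as leading
  monomial the product of all variables, and those of size greater than \<open>t\<close> already lie in the required power;
  since the square of the \<open>t\<close>-minor among them is divisible by \<open>\<mu>\<close> modulo \<open>I\<close>, this gives traces that send
  \<open>\<mu> ^ h\<close> to \<open>1\<close>. Applying the composite trace to \<open>c * x ^ q \<in> J\<^sup>[\<^sup>q\<^sup>]\<close> gives \<open>x \<in> J\<close>.\<close>

section \<open>Polynomials and monomials\<close>

text \<open>The obstacle is that \<open>I\<close> is in general not generated by \<open>h\<close>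
  elements, so there is no explicit description of the \<open>g\<close> for which
  \<open>\<Phi> (g * _)\<close> preserves it. Controlling \<open>g\<close> up to a power of \<mu> is
  enough: a factor \<mu>^(N q) leaves the trace as \<mu>^N, which cancels because \<open>I\<close>
  is prime and does not contain \<mu>. Here h = (n - t)(n - t + 1)/2 counts the variables outside
  the first \<open>t\<close> rows and columns. Neither choice of \<open>g\<close> does the work of
  the other. A bordered minor is \<mu> times its own such variable plus a polynomial in the
  remaining variables, which therefore stay free to be matched with a monomial of \<open>c\<close>;
  the price is \<mu>^(h(q - 1)), completed to a q-th power by \<open>h\<close> further factors,
  whence the value \<mu>^h. The diagonal product has trace 1 at exponent q - 1 but no factor \<mu>
  to spare: 2h copies of its t-minor are traded for \<mu>^h, whence the condition
  \<open>2 * h \<le> q - 1\<close>. The field may be imperfect: a retraction of Frobenius replaces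
  the q-th root.\<close>

abbreviation "keys \<equiv> Poly_Mapping.keys"
abbreviation "lookup \<equiv> Poly_Mapping.lookup"

type_synonym mono = "(nat \<times> nat) \<Rightarrow>\<^sub>0 nat"

lemma lookup_single_mult_add:
  fixes k m :: "'a::cancel_comm_monoid_add" and b :: "'a \<Rightarrow>\<^sub>0 'b::comm_semiring_1"
  shows "lookup (Poly_Mapping.single k c * b) (k + m) = c * lookup b m"
proof -
  have *: "(Poly_Mapping.lookup (Poly_Mapping.single k c) l * (\<Sum>q. Poly_Mapping.lookup b q when k + m = l + q))
      = (c * lookup b m when l = k)" for l
    by (auto simp: lookup_single when_def)
  show ?thesis
    unfolding lookup_mult * by simp
qed

lemma poly_as_sum: "p = (\<Sum>m\<in>keys p. Poly_Mapping.single m (lookup p m))"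
  by (rule poly_mapping_eqI) (auto simp: lookup_sum lookup_single when_def in_keys_iff)

lemma poly_mapping_add_induct [case_names single add]:
  assumes "\<And>m c. P (Poly_Mapping.single m c)" and "\<And>p q. P p \<Longrightarrow> P q \<Longrightarrow> P (p + q)"
  shows "P (p :: 'a \<Rightarrow>\<^sub>0 'b::comm_monoid_add)"
proof -
  have "P (\<Sum>m\<in>A. Poly_Mapping.single m (lookup p m))" if "finite A" for A
    using that
  proof (induction A rule: finite_induct)
    case empty
    \<comment> \<open>The zero polynomial is a monomial with coefficient 0, so the induction needs
      no separate base case.\<close>
    have "P (Poly_Mapping.single undefined 0)" by (rule assms(1))
    then show ?case by simp
  qed (auto intro: assms)
  from this[of "keys p"] show ?thesis by (simp flip: poly_as_sum)
qed

lemma mono_induct [case_names zero add]: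
  assumes "P 0" and "\<And>m v. P m \<Longrightarrow> P (m + Poly_Mapping.single v 1)"
  shows "P (m :: 'a \<Rightarrow>\<^sub>0 nat)"
proof -
  have 1: "P (m + Poly_Mapping.single v k)" if "P m" for m v k
  proof (induction k)
    case (Suc k)
    have "m + Poly_Mapping.single v (Suc k) = m + Poly_Mapping.single v k + Poly_Mapping.single v 1"
      by (simp add: add.assoc flip: single_add)
    then show ?case using assms(2) Suc by simp
  qed (use that in simp)
  have "P (\<Sum>v\<in>A. Poly_Mapping.single v (lookup m v))" if "finite A" for A
    using that
    by (induction A rule: finite_induct)
      (auto simp: assms(1) 1 add.commute[of "Poly_Mapping.single _ _"])
  from this[of "keys m"] show ?thesis by (simp flip: poly_as_sum)
qed

lemma CHAR_poly_mapping:
  "CHAR('a::comm_monoid_add \<Rightarrow>\<^sub>0 'b::comm_semiring_1) = CHAR('b)"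
proof (rule CHAR_eqI)
  fix n assume "of_nat n = (0 :: 'a \<Rightarrow>\<^sub>0 'b)"
  then have "lookup (Poly_Mapping.single (0::'a) (of_nat n :: 'b)) 0 = 0" by simp
  then show "CHAR('b) dvd n" by (simp add: lookup_of_nat of_nat_eq_0_iff_char_dvd)
qed (simp flip: single_of_nat)

lemma keys_add_nat: "keys (m + m' :: 'a \<Rightarrow>\<^sub>0 nat) = keys m \<union> keys m'"
  by (auto simp: in_keys_iff lookup_add)

lemma mono_minus_single:
  fixes m :: "'a \<Rightarrow>\<^sub>0 nat"
  assumes "v \<in> keys m"
  shows "m = (m - Poly_Mapping.single v 1) + Poly_Mapping.single v 1"
  using assms by (intro poly_mapping_eqI) (auto simp: lookup_add lookup_minus lookup_single when_def in_keys_iff)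

section \<open>Polynomials in a prescribed set of variables\<close>

text \<open>The type has a variable for every pair of naturals, so membership in the intended ring
  is tracked by hand. The set \<open>V\<close> is a parameter because it is later also restricted to
  the first \<open>t\<close> rows.\<close>

definition polys :: "'v set \<Rightarrow> (('v \<Rightarrow>\<^sub>0 nat) \<Rightarrow>\<^sub>0 'k::comm_ring_1) set" where
  "polys V = {p. \<forall>m\<in>keys p. keys m \<subseteq> V}"

lemma carrier_sym_poly_ring: "carrier (sym_poly_ring n) = polys (sym_vars n)"
  by (simp add: sym_poly_ring_def polys_def)

lemma polys_0 [simp]: "0 \<in> polys V" and polys_1 [simp]: "1 \<in> polys V"
  by (auto simp: polys_def)

lemma polys_add: "p \<in> polys V \<Longrightarrow> q \<in> polys V \<Longrightarrow> p + q \<in> polys V"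
  using keys_add[of p q] by (fastforce simp: polys_def)

lemma polys_mult: "p \<in> polys V \<Longrightarrow> q \<in> polys V \<Longrightarrow> p * q \<in> polys V"
  using keys_mult[of p q] by (fastforce simp: polys_def keys_add_nat)

lemma polys_uminus: "p \<in> polys V \<Longrightarrow> - p \<in> polys V"
  by (auto simp: polys_def in_keys_iff)

lemma polys_diff: "p \<in> polys V \<Longrightarrow> q \<in> polys V \<Longrightarrow> p - q \<in> polys V"
  using polys_add[of p V "- q"] polys_uminus[of q V] by simp

lemma polys_single: "keys m \<subseteq> V \<Longrightarrow> Poly_Mapping.single m c \<in> polys V"
  by (auto simp: polys_def)

lemma polys_power: "p \<in> polys V \<Longrightarrow> p ^ k \<in> polys V"
  by (induction k) (auto intro: polys_mult)

lemma polys_sum: "(\<And>i. i \<in> A \<Longrightarrow> f i \<in> polys V) \<Longrightarrow> sum f A \<in> polys V"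
  by (induction A rule: infinite_finite_induct) (auto intro: polys_add)

lemma polys_prod: "(\<And>i. i \<in> A \<Longrightarrow> f i \<in> polys V) \<Longrightarrow> prod f A \<in> polys V"
  by (induction A rule: infinite_finite_induct) (auto intro: polys_mult)

lemma polys_det:
  assumes "A \<in> carrier_mat s s" "\<And>i j. i < s \<Longrightarrow> j < s \<Longrightarrow> A $$ (i, j) \<in> polys V"
  shows "det A \<in> polys V"
proof -
  have "signof p \<in> polys V" for p :: "nat \<Rightarrow> nat"
    by (simp add: sign_def polys_uminus)
  then show ?thesis
    unfolding det_def'[OF assms(1)]
    by (intro polys_sum polys_mult polys_prod) (auto intro!: assms(2) dest: permutes_in_image)
qed

section \<open>Weights, substitution and leading monomials\<close>

text \<open>One additive functional on exponents serves for the weight \<open>wt\<close>, the index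
  multidegree \<open>content\<close> and the partial degree \<open>bottom_degree\<close>.\<close>

definition wsum :: "('v \<Rightarrow> nat) \<Rightarrow> ('v \<Rightarrow>\<^sub>0 nat) \<Rightarrow> nat" where
  "wsum g m = (\<Sum>v\<in>keys m. lookup m v * g v)"

lemma wsum_superset: "finite A \<Longrightarrow> keys m \<subseteq> A \<Longrightarrow> wsum g m = (\<Sum>v\<in>A. lookup m v * g v)"
  unfolding wsum_def by (rule sum.mono_neutral_left) (auto simp: in_keys_iff)

lemma wsum_0 [simp]: "wsum g 0 = 0"
  by (simp add: wsum_def)

lemma wsum_single [simp]: "wsum g (Poly_Mapping.single v k) = k * g v"
  by (simp add: wsum_def)

lemma wsum_add: "wsum g (m + m') = wsum g m + wsum g m'"
  using wsum_superset[of "keys m \<union> keys m'" "m + m'" g] wsum_superset[of "keys m \<union> keys m'" m g]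
    wsum_superset[of "keys m \<union> keys m'" m' g]
  by (simp add: keys_add_nat lookup_add distrib_right sum.distrib)

lemma wsum_sum: "wsum g (sum f A) = (\<Sum>i\<in>A. wsum g (f i))"
  by (induction A rule: infinite_finite_induct) (auto simp: wsum_add)

definition monval :: "('v \<Rightarrow> 'b::comm_semiring_1) \<Rightarrow> ('v \<Rightarrow>\<^sub>0 nat) \<Rightarrow> 'b" where
  "monval f m = (\<Prod>v\<in>keys m. f v ^ lookup m v)"

lemma monval_superset: "finite A \<Longrightarrow> keys m \<subseteq> A \<Longrightarrow> monval f m = (\<Prod>v\<in>A. f v ^ lookup m v)"
  unfolding monval_def by (rule prod.mono_neutral_left) (auto simp: in_keys_iff)

lemma monval_0 [simp]: "monval f 0 = 1"
  by (simp add: monval_def)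

lemma monval_single [simp]: "monval f (Poly_Mapping.single v k) = f v ^ k"
  by (simp add: monval_def)

lemma monval_add: "monval f (m + m') = monval f m * monval f m'"
  using monval_superset[of "keys m \<union> keys m'" "m + m'" f] monval_superset[of "keys m \<union> keys m'" m f]
    monval_superset[of "keys m \<union> keys m'" m' f]
  by (simp add: keys_add_nat lookup_add power_add prod.distrib)

definition subst :: "('v \<Rightarrow> ('w \<Rightarrow>\<^sub>0 nat) \<Rightarrow>\<^sub>0 'k::comm_ring_1) \<Rightarrow> (('v \<Rightarrow>\<^sub>0 nat) \<Rightarrow>\<^sub>0 'k) \<Rightarrow> (('w \<Rightarrow>\<^sub>0 nat) \<Rightarrow>\<^sub>0 'k)" where
  "subst f p = (\<Sum>m\<in>keys p. Poly_Mapping.single 0 (lookup p m) * monval f m)"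

lemma subst_superset:
  "finite A \<Longrightarrow> keys p \<subseteq> A \<Longrightarrow> subst f p = (\<Sum>m\<in>A. Poly_Mapping.single 0 (lookup p m) * monval f m)"
  unfolding subst_def by (rule sum.mono_neutral_left) (auto simp: in_keys_iff)

lemma subst_single [simp]: "subst f (Poly_Mapping.single m c) = Poly_Mapping.single 0 c * monval f m"
  by (cases "c = 0") (auto simp: subst_def)

lemma subst_add: "subst f (p + q) = subst f p + subst f q"
proof -
  have "keys (p + q) \<subseteq> keys p \<union> keys q" by (rule keys_add)
  then show ?thesis
    using subst_superset[of "keys p \<union> keys q" "p + q" f] subst_superset[of "keys p \<union> keys q" p f]
      subst_superset[of "keys p \<union> keys q" q f]
    by (simp add: lookup_add distrib_right sum.distrib single_add)
qed

lemma subst_mult: "subst f (p * q) = subst f p * subst f q"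
proof (induction p rule: poly_mapping_add_induct)
  case (single m c)
  show ?case
  proof (induction q rule: poly_mapping_add_induct)
    case (single m' c')
    have "subst f (Poly_Mapping.single m c * Poly_Mapping.single m' c')
        = (Poly_Mapping.single 0 c * Poly_Mapping.single 0 c') * (monval f m * monval f m')"
      by (simp add: mult_single monval_add)
    then show ?case by (simp only: subst_single mult_ac)
  qed (simp add: distrib_left subst_add)
qed (simp add: distrib_right subst_add)

lemma subst_1 [simp]: "subst f 1 = 1"
  using subst_single[of f 0 1] by simp

lemma subst_0 [simp]: "subst f 0 = 0"
  by (simp add: subst_def)

interpretation subst: comm_ring_hom "subst f"
  by unfold_locales (auto simp: subst_add subst_mult)

text \<open>A weight does not order monomials totally, so the definition asks for a unique heaviest
  monomial, with coefficient 1; ties among lighter ones are allowed.\<close>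

definition leads :: "('v \<Rightarrow> nat) \<Rightarrow> (('v \<Rightarrow>\<^sub>0 nat) \<Rightarrow>\<^sub>0 'k::comm_ring_1) \<Rightarrow> ('v \<Rightarrow>\<^sub>0 nat) \<Rightarrow> bool" where
  "leads g p m \<longleftrightarrow> lookup p m = 1 \<and> (\<forall>k\<in>keys p. k = m \<or> wsum g k < wsum g m)"

lemma leads_1: "leads g 1 0"
  by (auto simp: leads_def)

text \<open>Split off the leading term of \<open>p\<close>. The rest is strictly lighter and,
  multiplied by \<open>q\<close>, cannot reach \<open>m + m'\<close>; the leading term contributes
  the coefficient of \<open>m'\<close> in \<open>q\<close>, which is 1.\<close>

lemma leads_mult:
  assumes p: "leads g p m" and q: "leads g q m'"
  shows "leads g (p * q) (m + m')"
proof -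
  define p' where "p' = p - Poly_Mapping.single m 1"
  have pk: "wsum g k < wsum g m" if "k \<in> keys p'" for k
    using that p unfolding p'_def leads_def
    by (auto simp: in_keys_iff lookup_minus lookup_single when_def split: if_splits)
  have pe: "p = Poly_Mapping.single m 1 + p'" by (simp add: p'_def)
  have k1: "k = m + m' \<or> wsum g k < wsum g m + wsum g m'" if "k \<in> keys (p * q)" for k
  proof -
    obtain a b where "k = a + b" "a \<in> keys p" "b \<in> keys q"
      using \<open>k \<in> keys (p * q)\<close> keys_mult[of p q] by blast
    then show ?thesis using p q unfolding leads_def wsum_add
      by (metis add_less_mono add_strict_left_mono add_strict_right_mono wsum_add)
  qed
  have "m + m' \<notin> keys (p' * q)"
  proof
    assume "m + m' \<in> keys (p' * q)"
    then obtain a b where *: "m + m' = a + b" "a \<in> keys p'" "b \<in> keys q"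
      using keys_mult[of p' q] by blast
    then have "wsum g m + wsum g m' = wsum g a + wsum g b" by (metis wsum_add)
    moreover have "wsum g b \<le> wsum g m'" using q *(3) unfolding leads_def by force
    ultimately show False using pk[OF *(2)] by simp
  qed
  then have "lookup (p * q) (m + m') = 1"
    unfolding pe distrib_right lookup_add
    using q by (simp add: lookup_single_mult_add leads_def in_keys_iff)
  with k1 show ?thesis unfolding leads_def wsum_add by blast
qed

lemma leads_prod:
  "finite A \<Longrightarrow> (\<And>i. i \<in> A \<Longrightarrow> leads g (f i) (m i)) \<Longrightarrow> leads g (\<Prod>i\<in>A. f i) (\<Sum>i\<in>A. m i)"
  by (induction A rule: finite_induct) (auto simp: leads_1 leads_mult)

section \<open>Nested monomials and leading terms of minors\<close>

text \<open>This weight is strictly supermodular, which makes the diagonal term the unique heaviest term of a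
  minor and, among monomials in which every index occurs equally often, the nested one the lightest.\<close>

definition wt :: "nat \<times> nat \<Rightarrow> nat" where
  "wt v = (fst v + 1) * (snd v + 1)"

text \<open>The multidegree in which \<open>x_ij\<close> has degree e_i + e_j, so that a diagonal
  variable counts twice.\<close>

definition content :: "mono \<Rightarrow> nat \<Rightarrow> nat" where
  "content m i = wsum (\<lambda>v. of_bool (fst v = i) + of_bool (snd v = i)) m"

definition ordered :: "mono \<Rightarrow> bool" where
  "ordered m \<longleftrightarrow> (\<forall>v\<in>keys m. fst v \<le> snd v)"

text \<open>Read \<open>(i, j)\<close> as the interval from \<open>i\<close> to \<open>j\<close>:
  any two intervals occurring in \<open>m\<close> are comparable under inclusion.\<close>

definition nested :: "mono \<Rightarrow> bool" where
  "nested m \<longleftrightarrow> (\<forall>u\<in>keys m. \<forall>v\<in>keys m. \<not> (fst u < fst v \<and> snd u < snd v))"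

lemma content_add: "content (m + m') i = content m i + content m' i"
  by (simp add: content_def wsum_add)

lemma content_0 [simp]: "content 0 i = 0"
  by (simp add: content_def)

lemma content_pos_iff: "0 < content m i \<longleftrightarrow> (\<exists>v\<in>keys m. fst v = i \<or> snd v = i)"
proof -
  have "content m i = 0 \<longleftrightarrow> (\<forall>v\<in>keys m. \<not> (fst v = i \<or> snd v = i))"
    unfolding content_def wsum_def by (subst sum_eq_0_iff) (auto simp: in_keys_iff)
  then show ?thesis by auto
qed

lemma finite_content: "finite {i. 0 < content m i}"
proof -
  have "{i. 0 < content m i} \<subseteq> fst ` keys m \<union> snd ` keys m"
    by (auto simp: content_pos_iff)
  then show ?thesis by (rule finite_subset) auto
qed

text \<open>The intervals form a chain under inclusion, and the outermost one has both extreme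
  endpoints.\<close>

lemma nested_extreme_pair:
  assumes "nested m" "ordered m" "m \<noteq> 0"
  shows "(Min {i. 0 < content m i}, Max {i. 0 < content m i}) \<in> keys m"
proof -
  let ?S = "{i. 0 < content m i}"
  have S: "fst v \<in> ?S" "snd v \<in> ?S" if "v \<in> keys m" for v
    using that by (auto simp: content_pos_iff)
  obtain v0 where "v0 \<in> keys m" using assms(3) by (metis all_not_in_conv keys_eq_empty)
  then have ne: "?S \<noteq> {}" using S(1) by blast
  have "Min ?S \<in> ?S" "Max ?S \<in> ?S"
    using Min_in[OF finite_content ne] Max_in[OF finite_content ne] by auto
  then obtain u v where u: "u \<in> keys m" "fst u = Min ?S \<or> snd u = Min ?S"
    and v: "v \<in> keys m" "fst v = Max ?S \<or> snd v = Max ?S"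
    by (auto simp: content_pos_iff)
  have b: "Min ?S \<le> fst w" "snd w \<le> Max ?S" if "w \<in> keys m" for w
    using S[OF that] finite_content by auto
  have o: "fst w \<le> snd w" if "w \<in> keys m" for w
    using assms(2) that by (auto simp: ordered_def)
  have 1: "fst u = Min ?S" "snd v = Max ?S"
    using u v b[OF u(1)] b[OF v(1)] o[OF u(1)] o[OF v(1)] by auto
  have "\<not> (fst u < fst v \<and> snd u < snd v)" using assms(1) u v by (auto simp: nested_def)
  then have "snd u = Max ?S \<or> fst v = Min ?S"
    using 1 b[OF u(1)] b[OF v(1)] by linarith
  then show ?thesis using 1 u(1) v(1) by (metis prod.collapse)
qed

lemma keys_minus_subset: "keys (m - m' :: 'a \<Rightarrow>\<^sub>0 nat) \<subseteq> keys m"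
  by (auto simp: in_keys_iff lookup_minus)

text \<open>The content determines the outermost interval; remove it from both monomials and induct
  on the degree.\<close>

lemma nested_unique:
  assumes "nested m" "nested m'" "ordered m" "ordered m'" "content m = content m'"
  shows "m = m'"
  using assms
proof (induction "wsum (\<lambda>_. 1) m" arbitrary: m m' rule: less_induct)
  case less
  show ?case
  proof (cases "m = 0 \<or> m' = 0")
    case True
    have "x = 0" if "content x = content 0" for x
    proof (rule ccontr)
      assume "x \<noteq> 0"
      then obtain v where "v \<in> keys x" by (metis all_not_in_conv keys_eq_empty)
      then have "0 < content x (fst v)" by (auto simp: content_pos_iff)
      then show False using that by simp
    qed
    then show ?thesis using True less.prems(5) by metis
  next
    case False
    define v where "v = (Min {i. 0 < content m i}, Max {i. 0 < content m i})"
    have v: "v \<in> keys m" "v \<in> keys m'"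
      using nested_extreme_pair[of m] nested_extreme_pair[of m'] less.prems False
      by (auto simp: v_def)
    let ?s = "Poly_Mapping.single v (1::nat)"
    have m: "m = (m - ?s) + ?s" "m' = (m' - ?s) + ?s"
      using v[THEN mono_minus_single] by auto
    have k: "keys (m - ?s) \<subseteq> keys m" "keys (m' - ?s) \<subseteq> keys m'"
      by (rule keys_minus_subset)+
    have "m - ?s = m' - ?s"
    proof (rule less.hyps)
      show "wsum (\<lambda>_. 1) (m - ?s) < wsum (\<lambda>_. 1) m"
        by (subst (2) m(1)) (simp add: wsum_add)
      have "content (m - ?s) i = content (m' - ?s) i" for i
        using less.prems(5) m content_add by (metis add_right_cancel)
      then show "content (m - ?s) = content (m' - ?s)" by blast
      show "nested (m - ?s)" "nested (m' - ?s)" "ordered (m - ?s)" "ordered (m' - ?s)"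
        using less.prems(1-4) k unfolding nested_def ordered_def by blast+
    qed
    then show ?thesis using m by metis
  qed
qed

lemma not_nested_swap:
  assumes "ordered m" "\<not> nested m"
  obtains m' where "ordered m'" "content m' = content m" "wsum wt m' < wsum wt m"
proof -
  obtain u v where u: "u \<in> keys m" and v: "v \<in> keys m" and lt: "fst u < fst v" "snd u < snd v"
    using assms(2) by (auto simp: nested_def)
  obtain a b c d where uv: "u = (a, b)" "v = (c, d)" by (metis prod.collapse)
  define m0 where "m0 = m - Poly_Mapping.single u 1 - Poly_Mapping.single v 1"
  have "v \<in> keys (m - Poly_Mapping.single u 1)"
    using u v lt by (auto simp: in_keys_iff lookup_minus lookup_single when_def)
  then have m: "m = m0 + Poly_Mapping.single u 1 + Poly_Mapping.single v 1"
    using mono_minus_single[OF u] mono_minus_single[of v "m - Poly_Mapping.single u 1"]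
    unfolding m0_def by (metis add.assoc add.commute)
  \<comment> \<open>The same four indices are paired as an outer and an inner interval. This keeps
    the content and lowers the weight by (c - a)(d - b).\<close>
  define m' where "m' = m0 + Poly_Mapping.single (a, d) 1 + Poly_Mapping.single (min b c, max b c) 1"
  have o: "a \<le> b" "c \<le> d" using assms(1) u v uv by (auto simp: ordered_def)
  have l: "a < c" "b < d" using lt uv by auto
  show ?thesis
  proof
    have "keys m0 \<subseteq> keys m" unfolding m0_def by (meson keys_minus_subset order_trans)
    then show "ordered m'" using assms(1) o l unfolding ordered_def m'_def keys_add_nat
      by auto
    show "content m' = content m"
      by (rule ext) (auto simp: m m'_def content_def wsum_add uv min_def max_def)
    have "(a+1)*(d+1) + (b+1)*(c+1) < (a+1)*(b+1) + (c+1)*(d+1)"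
    proof -
      obtain x y where "c = a + x" "x > 0" "d = b + y" "y > 0" using l
        by (metis add.commute less_imp_add_positive)
      then show ?thesis by (simp add: algebra_simps)
    qed
    then show "wsum wt m' < wsum wt m"
      by (auto simp: m m'_def wsum_add uv wt_def min_def max_def algebra_simps)
  qed
qed

text \<open>Swapping lowers the weight, so it ends at a nested monomial of the same content, and
  there is only one.\<close>

lemma nested_min_weight:
  assumes "nested m" "ordered m" "ordered m'" "content m' = content m"
  shows "wsum wt m \<le> wsum wt m' \<and> (wsum wt m = wsum wt m' \<longrightarrow> m = m')"
  using assms(3,4)
proof (induction "wsum wt m'" arbitrary: m' rule: less_induct)
  case less
  show ?case
  proof (cases "nested m'")
    case True
    then have "m = m'" using nested_unique[OF assms(1) True assms(2) less.prems(1)] less.prems(2) by metis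
    then show ?thesis by simp
  next
    case False
    then obtain m'' where "ordered m''" "content m'' = content m'" "wsum wt m'' < wsum wt m'"
      using not_nested_swap less.prems(1) by blast
    then have "wsum wt m \<le> wsum wt m''" using less.hyps[of m''] less.prems by metis
    then show ?thesis using \<open>wsum wt m'' < wsum wt m'\<close> by simp
  qed
qed

section \<open>Rearrangement and the leading term of a minor\<close>

text \<open>Monotonicity gives \<open>i \<le> p i\<close>, and since both sides have the same sum
  over \<open>i\<close>, equality holds everywhere.\<close>

lemma permutes_no_inversion:
  assumes p: "p permutes {0..<s::nat}" and "\<And>i j. i < j \<Longrightarrow> j < s \<Longrightarrow> p i < p j"
  shows "p = id"
proof -
  have ge: "i < s \<Longrightarrow> i \<le> p i" for i
  proof (induction i)
    case (Suc i)
    then show ?case using assms(2)[of i "Suc i"] by simp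
  qed simp
  have "(\<Sum>i=0..<s. p i) = (\<Sum>i=0..<s. i)"
    using sum.permute[OF p, of "\<lambda>i. i"] by (simp add: o_def)
  then have "\<forall>i\<in>{0..<s}. p i = i"
    using sum_mono_inv[of "\<lambda>i. i" "{0..<s}" p] ge by (metis atLeastLessThan_iff finite_atLeastLessThan)
  then show ?thesis using p by (intro ext) (metis permutes_not_in id_apply)
qed

text \<open>A permutation with an inversion does not maximise the sum: undo the inversion.\<close>

lemma strict_rearrangement:
  fixes a b :: "nat \<Rightarrow> nat"
  assumes a: "\<And>i j. i < j \<Longrightarrow> j < s \<Longrightarrow> a i < a j" and b: "\<And>i j. i < j \<Longrightarrow> j < s \<Longrightarrow> b i < b j"
    and p: "p permutes {0..<s}" "p \<noteq> id"
  shows "(\<Sum>i=0..<s. a i * b (p i)) < (\<Sum>i=0..<s. a i * b i)"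
proof -
  let ?W = "\<lambda>p. \<Sum>i=0..<s. a i * b (p i)"
  let ?P = "{p. p permutes {0..<s}}"
  have improve: "\<exists>p'\<in>?P. ?W p < ?W p'" if p: "p \<in> ?P" "p \<noteq> id" for p
  proof -
    obtain i j where ij: "i < j" "j < s" "\<not> p i < p j"
      using permutes_no_inversion[of p s] p by auto
    moreover have "p i \<noteq> p j" using p(1) ij permutes_inj[of p] by (metis inj_eq less_irrefl mem_Collect_eq)
    ultimately have pj: "p j < p i" by simp
    define p' where "p' = p \<circ> Transposition.transpose i j"
    have P: "p' \<in> ?P" unfolding p'_def using p ij
      by (auto intro!: permutes_compose permutes_swap_id)
    have pis: "p i < s" using p ij permutes_in_image[of p "{0..<s}" i] by auto
    have split: "?W q = a i * b (q i) + a j * b (q j) + (\<Sum>k\<in>{0..<s}-{i,j}. a k * b (q k))" for q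
    proof -
      have "?W q = (\<Sum>k\<in>{i,j}. a k * b (q k)) + (\<Sum>k\<in>{0..<s}-{i,j}. a k * b (q k))"
        using ij by (subst sum.subset_diff[of "{i,j}"]) auto
      then show ?thesis using ij by simp
    qed
    have rest: "(\<Sum>k\<in>{0..<s}-{i,j}. a k * b (p' k)) = (\<Sum>k\<in>{0..<s}-{i,j}. a k * b (p k))"
      by (rule sum.cong) (auto simp: p'_def transpose_def)
    have "a i * b (p i) + a j * b (p j) < a i * b (p j) + a j * b (p i)"
    proof -
      obtain x y where "a j = a i + x" "x > 0" "b (p i) = b (p j) + y" "y > 0"
        using a[OF ij(1,2)] b[OF pj pis] by (metis less_imp_add_positive)
      then show ?thesis by (simp add: algebra_simps)
    qed
    then have "?W p < ?W p'"
      unfolding split rest by (simp add: p'_def)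
    then show ?thesis using P by blast
  qed
  \<comment> \<open>A maximiser exists by finiteness and can only be the identity, since anything
    else can be improved. Every other \<open>p\<close> is strictly below some value, hence below
    that of the identity.\<close>
  have fin: "finite (?W ` ?P)" by (intro finite_imageI finite_permutations) auto
  have "Max (?W ` ?P) \<in> ?W ` ?P" using fin p by (intro Max_in) auto
  then obtain q where q: "q \<in> ?P" "?W q = Max (?W ` ?P)" by auto
  have qmax: "?W p' \<le> ?W q" if "p' \<in> ?P" for p' using q(2) fin that by simp
  have "q = id" using improve[OF q(1)] qmax by (meson leD)
  obtain p' where "p' \<in> ?P" "?W p < ?W p'" using improve[of p] p by auto
  then show ?thesis using qmax[of p'] \<open>q = id\<close> by simp
qed

definition xmono :: "nat \<Rightarrow> nat \<Rightarrow> mono" where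
  "xmono i j = Poly_Mapping.single (min i j, max i j) 1"

lemma xvar_xmono: "xvar i j = Poly_Mapping.single (xmono i j) 1"
  by (simp add: xvar_def xmono_def)

lemma weight_xmono [simp]: "wsum wt (xmono i j) = (i + 1) * (j + 1)"
  by (simp add: xmono_def wt_def min_def max_def)

lemma prod_single_one:
  "(\<Prod>i\<in>A. Poly_Mapping.single (m i) (1::'k::comm_semiring_1)) = Poly_Mapping.single (\<Sum>i\<in>A. m i) 1"
  by (induction A rule: infinite_finite_induct) (auto simp: mult_single)

text \<open>By symmetry of the matrix different Leibniz terms may carry the same monomial, but every
  one with \<open>p \<noteq> id\<close> is strictly lighter than the diagonal term by rearrangement,
  so nothing cancels the latter.\<close>

lemma leads_minor:
  fixes a b :: "nat \<Rightarrow> nat"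
  assumes a: "\<And>i j. i < j \<Longrightarrow> j < s \<Longrightarrow> a i < a j" and b: "\<And>i j. i < j \<Longrightarrow> j < s \<Longrightarrow> b i < b j"
  shows "leads wt (det (mat s s (\<lambda>(i, j). xvar (a i) (b j))) :: 'k::comm_ring_1 mpoly)
    (\<Sum>i<s. xmono (a i) (b i))"
proof -
  let ?P = "{p. p permutes {0..<s}}"
  let ?m = "\<lambda>p. \<Sum>i=0..<s. xmono (a i) (b (p i))"
  have det: "det (mat s s (\<lambda>(i, j). xvar (a i) (b j))) = (\<Sum>p\<in>?P. Poly_Mapping.single (?m p) (signof p :: 'k))"
  proof -
    have "signof p * (\<Prod>i = 0..<s. mat s s (\<lambda>(i, j). xvar (a i) (b j)) $$ (i, p i))
        = Poly_Mapping.single (?m p) (signof p :: 'k)" if p: "p permutes {0..<s}" for p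
    proof -
      have "p i < s" if "i < s" for i using permutes_in_image[OF p, of i] that by auto
      then have "(\<Prod>i = 0..<s. mat s s (\<lambda>(i, j). xvar (a i) (b j)) $$ (i, p i))
        = Poly_Mapping.single (?m p) (1 :: 'k)"
        by (simp add: xvar_xmono flip: prod_single_one)
      then show ?thesis
        by (auto simp: sign_def single_uminus)
    qed
    then show ?thesis by (simp add: det_def'[of _ s])
  qed
  have wm: "wsum wt (?m p) = (\<Sum>i=0..<s. (a i + 1) * (b (p i) + 1))" for p
    by (simp add: wsum_sum)
  have lt: "wsum wt (?m p) < wsum wt (?m id)" if "p \<in> ?P" "p \<noteq> id" for p
    unfolding wm id_apply
    by (rule strict_rearrangement[of s "\<lambda>i. a i + 1" "\<lambda>i. b i + 1"]) (use a b that in auto)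
  have "lookup (\<Sum>p\<in>?P. Poly_Mapping.single (?m p) (signof p :: 'k)) (?m id)
      = (\<Sum>p\<in>?P. if p = id then 1 else 0)"
    unfolding lookup_sum
  proof (rule sum.cong)
    fix p assume "p \<in> ?P"
    then show "lookup (Poly_Mapping.single (?m p) (signof p :: 'k)) (?m id) = (if p = id then 1 else 0)"
      using lt[of p] by (cases "p = id") (auto simp: lookup_single when_def sign_id)
  qed simp
  also have "\<dots> = 1"
    by (subst sum.delta) (auto intro: finite_permutations permutes_id)
  finally have 1: "lookup (\<Sum>p\<in>?P. Poly_Mapping.single (?m p) (signof p :: 'k)) (?m id) = 1" .
  have "k = ?m id \<or> wsum wt k < wsum wt (?m id)"
    if "k \<in> keys (\<Sum>p\<in>?P. Poly_Mapping.single (?m p) (signof p :: 'k))" for k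
  proof -
    have "k \<in> (\<Union>p\<in>?P. keys (Poly_Mapping.single (?m p) (signof p :: 'k)))"
      using that keys_sum[of "\<lambda>p. Poly_Mapping.single (?m p) (signof p :: 'k)" ?P] by blast
    then obtain p where "p \<in> ?P" "k = ?m p" by (auto split: if_splits)
    then show ?thesis using lt[of p] by blast
  qed
  with 1 show ?thesis
    unfolding det leads_def by (simp add: atLeast0LessThan)
qed

section \<open>Powers of ideals and determinants of low rank perturbations\<close>

text \<open>The ideal generated in the whole type, with no restriction on variables. This is
  harmless because its elements are only tested through \<open>ev\<close>.\<close>

inductive_set idl :: "'a::comm_ring_1 set \<Rightarrow> 'a set" for B where
  idl_0 [simp]: "0 \<in> idl B"
| idl_step: "x \<in> idl B \<Longrightarrow> b \<in> B \<Longrightarrow> r * b + x \<in> idl B"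

lemma idl_base: "b \<in> B \<Longrightarrow> b \<in> idl B"
  using idl_step[OF idl_0, of b B 1] by simp

lemma idl_add: "x \<in> idl B \<Longrightarrow> y \<in> idl B \<Longrightarrow> x + y \<in> idl B"
  by (induction x rule: idl.induct) (auto simp: add.assoc intro: idl_step)

lemma idl_mult: "x \<in> idl B \<Longrightarrow> r * x \<in> idl B"
  by (induction x rule: idl.induct) (auto simp: distrib_left mult.assoc[symmetric] intro: idl_step)

lemma idl_sum: "(\<And>i. i \<in> A \<Longrightarrow> f i \<in> idl B) \<Longrightarrow> sum f A \<in> idl B"
  by (induction A rule: infinite_finite_induct) (auto intro: idl_add)

lemma idl_subset: "B \<subseteq> idl C \<Longrightarrow> idl B \<subseteq> idl C"
proof
  fix x assume "B \<subseteq> idl C" "x \<in> idl B"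
  from this(2,1) show "x \<in> idl C"
    by (induction x rule: idl.induct) (auto intro: idl_add idl_mult)
qed

lemma idl_mult2:
  assumes "x \<in> idl B" "y \<in> idl C" "\<And>b c. b \<in> B \<Longrightarrow> c \<in> C \<Longrightarrow> b * c \<in> idl D"
  shows "x * y \<in> idl D"
  using assms(1)
proof (induction x rule: idl.induct)
  case (idl_step x b r)
  have "b * y \<in> idl D" using assms(2)
  proof (induction y rule: idl.induct)
    case (idl_step y c s)
    have "b * (s * c + y) = s * (b * c) + b * y" by (simp add: algebra_simps)
    then show ?case using idl_step assms(3)[OF \<open>b \<in> B\<close> idl_step(2)] by (auto intro: idl_add idl_mult)
  qed simp
  then show ?case using idl_step by (auto simp: distrib_right mult.assoc intro: idl_add idl_mult)
qed simp

section \<open>Powers of an ideal\<close>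

definition ipow :: "'a::comm_ring_1 set \<Rightarrow> nat \<Rightarrow> 'a set" where
  "ipow G k = idl {prod_mset M | M. set_mset M \<subseteq> G \<and> size M = k}"

lemma ipow_mult_left: "x \<in> ipow G k \<Longrightarrow> r * x \<in> ipow G k"
  and ipow_sum: "(\<And>i. i \<in> A \<Longrightarrow> f i \<in> ipow G k) \<Longrightarrow> sum f A \<in> ipow G k"
  unfolding ipow_def by (auto intro: idl_mult idl_sum)

lemma ipow_zero [simp]: "ipow G 0 = UNIV"
proof -
  have "x \<in> ipow G 0" for x
  proof -
    have "prod_mset {#} \<in> ipow G 0" unfolding ipow_def by (rule idl_base) auto
    then show ?thesis using ipow_mult_left[of 1 G 0 x] by simp
  qed
  then show ?thesis by blast
qed

lemma ipow_one: "ipow G (Suc 0) = idl G"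
proof -
  have "{prod_mset M | M. set_mset M \<subseteq> G \<and> size M = Suc 0} = G"
  proof (intro equalityI subsetI)
    fix x assume "x \<in> {prod_mset M | M. set_mset M \<subseteq> G \<and> size M = Suc 0}"
    then obtain M where "x = prod_mset M" "set_mset M \<subseteq> G" "size M = 1" by auto
    then show "x \<in> G" using size_1_singleton_mset[of M] by auto
  next
    fix x assume "x \<in> G"
    then have "x = prod_mset {#x#} \<and> set_mset {#x#} \<subseteq> G \<and> size {#x#} = Suc 0" by simp
    then show "x \<in> {prod_mset M | M. set_mset M \<subseteq> G \<and> size M = Suc 0}" by blast
  qed
  then show ?thesis by (simp add: ipow_def)
qed

lemma ipow_mult:
  assumes "x \<in> ipow G a" "y \<in> ipow G b"
  shows "x * y \<in> ipow G (a + b)"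
  using assms unfolding ipow_def
proof (rule idl_mult2)
  fix c d assume "c \<in> {prod_mset M |M. set_mset M \<subseteq> G \<and> size M = a}"
    "d \<in> {prod_mset M |M. set_mset M \<subseteq> G \<and> size M = b}"
  then obtain M N where "c = prod_mset M" "d = prod_mset N" "set_mset (M + N) \<subseteq> G" "size (M + N) = a + b"
    by auto
  then show "c * d \<in> idl {prod_mset M |M. set_mset M \<subseteq> G \<and> size M = a + b}"
    by (metis (mono_tags, lifting) idl_base mem_Collect_eq prod_mset_Un)
qed

lemma ipow_antimono: "a \<le> b \<Longrightarrow> ipow G b \<subseteq> ipow G a"
  unfolding ipow_def
proof (rule idl_subset, rule subsetI)
  fix x assume "a \<le> b" "x \<in> {prod_mset M |M. set_mset M \<subseteq> G \<and> size M = b}"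
  then obtain M where M: "x = prod_mset M" "set_mset M \<subseteq> G" "size M = b" by blast
  obtain xs where xs: "mset xs = M" using ex_mset by blast
  then have "mset (take a xs) \<subseteq># M"
    by (metis append_take_drop_id mset_append mset_subset_eq_add_left)
  moreover have "size (mset (take a xs)) = a" using xs \<open>a \<le> b\<close> M(3) by auto
  ultimately obtain N where "N \<subseteq># M" "size N = a" by blast
  then have "x = prod_mset (M - N) * prod_mset N" "set_mset N \<subseteq> G"
    using M(1,2) set_mset_mono[of N M] by (auto simp flip: prod_mset_Un)
  moreover have "prod_mset N \<in> idl {prod_mset M |M. set_mset M \<subseteq> G \<and> size M = a}"
    by (rule idl_base) (use calculation \<open>size N = a\<close> in auto)
  ultimately show "x \<in> idl {prod_mset M |M. set_mset M \<subseteq> G \<and> size M = a}"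
    by (simp add: idl_mult)
qed

lemma ipow_power: "x \<in> ipow G a \<Longrightarrow> x ^ k \<in> ipow G (a * k)"
  by (induction k) (auto intro: ipow_mult)

lemma ipow_prod:
  "finite A \<Longrightarrow> (\<And>i. i \<in> A \<Longrightarrow> f i \<in> ipow G (h i)) \<Longrightarrow> prod f A \<in> ipow G (sum h A)"
  by (induction A rule: finite_induct) (auto intro: ipow_mult)

text \<open>In a product of more than \<open>card G * (q - 1)\<close> generators some generator
  occurs at least \<open>q\<close> times.\<close>

lemma ipow_pigeonhole:
  assumes "finite G" "card G * (q - 1) < k"
  shows "ipow G k \<subseteq> idl ((\<lambda>x. x ^ q) ` G)"
  unfolding ipow_def
proof (rule idl_subset, rule subsetI)
  fix x assume "x \<in> {prod_mset M |M. set_mset M \<subseteq> G \<and> size M = k}"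
  then obtain M where M: "x = prod_mset M" "set_mset M \<subseteq> G" "size M = k" by blast
  have "\<exists>g\<in>set_mset M. q \<le> count M g"
  proof (rule ccontr)
    assume "\<not> ?thesis"
    then have "count M g \<le> q - 1" if "g \<in> set_mset M" for g using that by force
    then have "size M \<le> card (set_mset M) * (q - 1)"
      unfolding size_multiset_overloaded_eq using sum_bounded_above[of "set_mset M" "count M" "q - 1"] by simp
    also have "\<dots> \<le> card G * (q - 1)" using M(2) assms(1) by (simp add: card_mono)
    finally show False using assms(2) M(3) by simp
  qed
  then obtain g where g: "g \<in> G" "replicate_mset q g \<subseteq># M"
    using M(2) by (auto simp: count_le_replicate_mset_subset_eq)
  then have "x = prod_mset (M - replicate_mset q g) * g ^ q"
    unfolding M(1) by (metis prod_mset_Un prod_mset_replicate_mset subset_mset.diff_add)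
  moreover have "g ^ q \<in> idl ((\<lambda>x. x ^ q) ` G)" using g(1) by (intro idl_base imageI)
  ultimately show "x \<in> idl ((\<lambda>x. x ^ q) ` G)" by (simp add: idl_mult)
qed

text \<open>The determinant of \<open>UV + E\<close> equals that of the block matrix with rows \<open>(1, -V)\<close> and \<open>(U, E)\<close>;
  each term of the Leibniz expansion of the latter has at least \<open>s - t\<close> factors in \<open>E\<close>.\<close>

lemma det_UV_plus_E:
  fixes u v e :: "nat \<Rightarrow> nat \<Rightarrow> 'a::idom"
  assumes e: "\<And>i j. i < s \<Longrightarrow> j < s \<Longrightarrow> e i j \<in> idl G"
  shows "det (mat s s (\<lambda>(i, j). (\<Sum>l<t. u i l * v l j) + e i j)) \<in> ipow G (s - t)"
proof -
  define U where "U = mat s t (\<lambda>(i, l). u i l)"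
  define V where "V = mat t s (\<lambda>(l, j). v l j)"
  define E where "E = mat s s (\<lambda>(i, j). e i j)"
  have [simp]: "U \<in> carrier_mat s t" "V \<in> carrier_mat t s" "E \<in> carrier_mat s s"
    by (auto simp: U_def V_def E_def)
  define B where "B = four_block_mat (1\<^sub>m t) (- V) U E"
  have UVE: "mat s s (\<lambda>(i, j). (\<Sum>l<t. u i l * v l j) + e i j) = U * V + E"
    by (rule eq_matI) (auto simp: U_def V_def E_def scalar_prod_def atLeast0LessThan)
  \<comment> \<open>Right multiplication by a unipotent block matrix clears the block
    \<open>- V\<close> and turns \<open>E\<close> into \<open>U * V + E\<close> without changing the
    determinant.\<close>
  have "B * four_block_mat (1\<^sub>m t) V (0\<^sub>m s t) (1\<^sub>m s) =
     four_block_mat (1\<^sub>m t * 1\<^sub>m t + (- V) * 0\<^sub>m s t) (1\<^sub>m t * V + (- V) * 1\<^sub>m s)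
       (U * 1\<^sub>m t + E * 0\<^sub>m s t) (U * V + E * 1\<^sub>m s)"
    unfolding B_def by (rule mult_four_block_mat[of _ t t _ s _ s _ _ t _ s]) auto
  also have "\<dots> = four_block_mat (1\<^sub>m t) (0\<^sub>m t s) U (U * V + E)"
  proof -
    have "1\<^sub>m t * V + (- V) * 1\<^sub>m s = 0\<^sub>m t s"
      by (rule eq_matI) (auto simp: V_def)
    moreover have "1\<^sub>m t * 1\<^sub>m t + (- V) * 0\<^sub>m s t = 1\<^sub>m t" "U * 1\<^sub>m t + E * 0\<^sub>m s t = U" "E * 1\<^sub>m s = E"
      using right_mult_zero_mat[of "- V" t s t] right_mult_zero_mat[of E s s t]
        right_mult_one_mat[of U s t] right_mult_one_mat[of E s s] by auto
    ultimately show ?thesis by simp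
  qed
  finally have "det B * det (four_block_mat (1\<^sub>m t) V (0\<^sub>m s t) (1\<^sub>m s))
      = det (four_block_mat (1\<^sub>m t) (0\<^sub>m t s) U (U * V + E))"
    by (subst det_mult[symmetric, of _ "t + s"]) (auto simp: B_def)
  then have det: "det B = det (U * V + E)"
    by (subst (asm) det_four_block_mat_lower_left_zero[of _ t _ s], simp_all,
        subst (asm) det_four_block_mat_upper_right_zero[of _ t _ s], simp_all)
  have B: "B \<in> carrier_mat (t + s) (t + s)" by (auto simp: B_def)
  have "det B \<in> ipow G (s - t)"
    unfolding det_def'[OF B]
  proof (intro ipow_sum ipow_mult_left)
    fix p assume "p \<in> {p. p permutes {0..<t + s}}"
    then have p: "p permutes {0..<t + s}" by simp
    let ?S = "{i\<in>{0..<t + s}. t \<le> i \<and> t \<le> p i}"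
    have pl: "p i < t + s" if "i < t + s" for i using permutes_in_image[OF p, of i] that by auto
    have "(\<Prod>i = 0..<t + s. B $$ (i, p i)) \<in> ipow G (\<Sum>i = 0..<t + s. of_bool (t \<le> i \<and> t \<le> p i))"
    proof (rule ipow_prod)
      fix i assume i: "i \<in> {0..<t + s}"
      show "B $$ (i, p i) \<in> ipow G (of_bool (t \<le> i \<and> t \<le> p i))"
      proof (cases "t \<le> i \<and> t \<le> p i")
        case True
        then have "B $$ (i, p i) = e (i - t) (p i - t)"
          using i pl[of i] by (auto simp: B_def E_def U_def)
        moreover have "i - t < s" "p i - t < s" using True i pl[of i] by auto
        ultimately show ?thesis using True e[of "i - t" "p i - t"] by (simp add: ipow_one)
      next
        case False
        then have "of_bool (t \<le> i \<and> t \<le> p i) = (0::nat)" by simp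
        then show ?thesis by (simp only: ipow_zero UNIV_I)
      qed
    qed simp
    also have "(\<Sum>i = 0..<t + s. of_bool (t \<le> i \<and> t \<le> p i)) = card ?S"
      by (simp add: of_bool_def sum.If_cases Int_def)
    finally have 1: "(\<Prod>i = 0..<t + s. B $$ (i, p i)) \<in> ipow G (card ?S)" .
    \<comment> \<open>At most \<open>t\<close> rows can be matched with the first \<open>t\<close>
      columns, so of the \<open>s\<close> lower rows at least \<open>s - t\<close> pick an entry of
      \<open>E\<close>.\<close>
    let ?Q = "{i\<in>{0..<t + s}. p i < t}"
    have "card ?Q \<le> card {0..<t}"
      by (rule card_inj_on_le[of p]) (auto intro: inj_on_subset[OF permutes_inj[OF p]])
    moreover have "card {t..<t + s} \<le> card (?S \<union> ?Q)" by (rule card_mono) auto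
    moreover have "card (?S \<union> ?Q) \<le> card ?S + card ?Q" by (rule card_Un_le)
    ultimately have "s - t \<le> card ?S" by simp
    with 1 show "(\<Prod>i = 0..<t + s. B $$ (i, p i)) \<in> ipow G (s - t)"
      using ipow_antimono by blast
  qed
  then show ?thesis unfolding UVE det .
qed

text \<open>The case \<open>E = 0\<close> with no generators: there is no product of
  \<open>s - t > 0\<close> elements of the empty set, so that power is zero.\<close>

lemma det_rank_less:
  fixes u v :: "nat \<Rightarrow> nat \<Rightarrow> 'a::idom"
  assumes "t < s"
  shows "det (mat s s (\<lambda>(i, j). \<Sum>l<t. u i l * v l j)) = 0"
proof -
  have "{prod_mset M |M. set_mset M \<subseteq> ({}::'a set) \<and> size M = s - t} = {}" using assms by auto
  moreover have "idl ({}::'a set) = {0}"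
    by (auto elim: idl.cases)
  ultimately have "ipow ({}::'a set) (s - t) = {0}" by (simp add: ipow_def)
  then show ?thesis using det_UV_plus_E[where e = "\<lambda>_ _. 0" and G = "{}" and s = s and t = t and u = u and v = v] by simp
qed

section \<open>Standard monomials in Gram matrices\<close>

definition yquad :: "nat \<Rightarrow> nat \<times> nat \<Rightarrow> mono" where
  "yquad k v = Poly_Mapping.single (k, fst v) 1 + Poly_Mapping.single (k, snd v) 1"

text \<open>The entry of the Gram matrix of a generic matrix with \<open>t\<close> rows. The
  variable \<open>y_ki\<close> reuses the key \<open>(k, i)\<close>; source and target of
  \<open>ev\<close> are the same type with unrelated meanings of the keys.\<close>

definition gram :: "nat \<Rightarrow> nat \<times> nat \<Rightarrow> 'k::comm_ring_1 mpoly" where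
  "gram t v = (\<Sum>k<t. Poly_Mapping.single (yquad k v) 1)"

abbreviation ev :: "nat \<Rightarrow> 'k::comm_ring_1 mpoly \<Rightarrow> 'k mpoly" where
  "ev t \<equiv> subst (gram t)"

text \<open>\<open>D k\<close> collects the variables for which the k-th summand of
  \<open>gram\<close> was chosen; the degrees of the resulting monomial in row \<open>k\<close> of
  the \<open>y\<close> are then the content of \<open>D k\<close>.\<close>

definition has_type :: "mono \<Rightarrow> (nat \<Rightarrow> mono) \<Rightarrow> bool" where
  "has_type w D \<longleftrightarrow> (\<forall>k i. lookup w (k, i) = content (D k) i)"

lemma lookup_yquad:
  "lookup (yquad k v) (k', i) = (if k' = k then content (Poly_Mapping.single v 1) i else 0)"
  by (auto simp: yquad_def content_def lookup_add lookup_single when_def)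

lemma keys_monval_gram:
  assumes "w \<in> keys (monval (gram t :: _ \<Rightarrow> 'k::comm_ring_1 mpoly) m)"
  shows "\<exists>D. (\<forall>k\<ge>t. D k = 0) \<and> m = (\<Sum>k<t. D k) \<and> has_type w D"
  using assms
proof (induction m arbitrary: w rule: mono_induct)
  case zero
  then show ?case by (intro exI[of _ "\<lambda>_. 0"]) (auto simp: has_type_def)
next
  case (add m v)
  then have "w \<in> keys (monval (gram t :: _ \<Rightarrow> 'k mpoly) m * gram t v)"
    by (simp add: monval_add)
  then obtain w' y where w: "w = w' + y" and w': "w' \<in> keys (monval (gram t :: _ \<Rightarrow> 'k mpoly) m)"
    and y: "y \<in> keys (gram t v :: 'k mpoly)"
    using keys_mult by blast
  obtain D where D: "\<forall>k\<ge>t. D k = 0" "m = (\<Sum>k<t. D k)" "has_type w' D"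
    using add.IH[OF w'] by blast
  have "y \<in> (\<Union>k\<in>{..<t}. keys (Poly_Mapping.single (yquad k v) (1::'k)))"
    using y keys_sum[of "\<lambda>k. Poly_Mapping.single (yquad k v) (1::'k)" "{..<t}"] unfolding gram_def by blast
  then obtain k where k: "k < t" "y = yquad k v" by auto
  let ?D = "D(k := D k + Poly_Mapping.single v 1)"
  have "has_type w ?D"
    using D(3) unfolding has_type_def w k(2) lookup_add lookup_yquad by (auto simp: content_add)
  moreover have "m + Poly_Mapping.single v 1 = (\<Sum>k<t. ?D k)"
    using k(1) by (simp add: D(2) sum.remove[of "{..<t}" k] add_ac)
  moreover have "\<forall>l\<ge>t. ?D l = 0" using D(1) k(1) by auto
  ultimately show ?case by blast
qed

section \<open>The distinguished coefficient of a monomial with nested classes\<close>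

definition part :: "(nat \<times> nat \<Rightarrow> nat) \<Rightarrow> nat \<Rightarrow> mono \<Rightarrow> mono" where
  "part r k m = (\<Sum>v\<in>{v\<in>keys m. r v = k}. Poly_Mapping.single v (lookup m v))"

lemma lookup_part: "lookup (part r k m) v = (if r v = k then lookup m v else 0)"
  by (auto simp: part_def lookup_sum lookup_single when_def in_keys_iff)

lemma keys_part: "keys (part r k m) = {v\<in>keys m. r v = k}"
  by (auto simp: in_keys_iff lookup_part split: if_splits)

lemma part_add: "part r k (m + m') = part r k m + part r k m'"
  by (rule poly_mapping_eqI) (auto simp: lookup_part lookup_add)

lemma part_single: "part r k (Poly_Mapping.single v c) = (if r v = k then Poly_Mapping.single v c else 0)"
  by (rule poly_mapping_eqI) (auto simp: lookup_part lookup_single when_def)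

lemma sum_part: "(\<And>v. v \<in> keys m \<Longrightarrow> r v < t) \<Longrightarrow> (\<Sum>k<t. part r k m) = m"
  by (rule poly_mapping_eqI) (auto simp: lookup_sum lookup_part in_keys_iff)

lemma keys_sum_nat: "finite A \<Longrightarrow> i \<in> A \<Longrightarrow> keys (D i :: 'a \<Rightarrow>\<^sub>0 nat) \<subseteq> keys (\<Sum>i\<in>A. D i)"
  by (auto simp: sum.remove[of A i] keys_add_nat)

text \<open>Each class \<open>part r k m\<close> is nested, hence the unique lightest monomial of
  its content. Summing over \<open>k\<close>, equal total weight forces equality class by
  class.\<close>

lemma decomposition_weight:
  assumes r: "\<And>v. v \<in> keys m \<Longrightarrow> r v < t" "\<And>k. nested (part r k m)" and o: "ordered m"
    and D: "ordered (\<Sum>k<t. D k)" "\<And>k. content (D k) = content (part r k m)"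
  shows "wsum wt m \<le> wsum wt (\<Sum>k<t. D k)"
    and "wsum wt m = wsum wt (\<Sum>k<t. D k) \<Longrightarrow> k < t \<Longrightarrow> D k = part r k m"
proof -
  have *: "wsum wt (part r k m) \<le> wsum wt (D k) \<and> (wsum wt (part r k m) = wsum wt (D k) \<longrightarrow> part r k m = D k)"
    if "k < t" for k
  proof (rule nested_min_weight)
    show "ordered (part r k m)" using o by (auto simp: ordered_def keys_part)
    show "ordered (D k)" using D(1) keys_sum_nat[of "{..<t}" k D] that unfolding ordered_def by blast
  qed (use r D in auto)
  have m: "wsum wt m = (\<Sum>k<t. wsum wt (part r k m))"
    by (subst sum_part[OF r(1), symmetric]) (auto simp: wsum_sum)
  show "wsum wt m \<le> wsum wt (\<Sum>k<t. D k)"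
    unfolding m wsum_sum using * by (intro sum_mono) auto
  assume "wsum wt m = wsum wt (\<Sum>k<t. D k)" "k < t"
  then have "wsum wt (part r k m) = wsum wt (D k)"
    unfolding m wsum_sum using sum_mono_inv[of "\<lambda>k. wsum wt (part r k m)" "{..<t}" "\<lambda>k. wsum wt (D k)" k] *
    by auto
  then show "D k = part r k m" using *[OF \<open>k < t\<close>] by metis
qed

lemma lookup_single_one_mult:
  "lookup (Poly_Mapping.single y (1::'b::comm_semiring_1) * q) (y + w) = lookup q (w :: 'a::cancel_comm_monoid_add)"
  by (simp add: lookup_single_mult_add)

text \<open>No other factorization contributes to the coefficient: moving a variable to a foreign class
  would give a decomposition of the same type and weight.\<close>

lemma coefficient_monval_gram:
  assumes "\<And>v. v \<in> keys m \<Longrightarrow> r v < t" "\<And>k. nested (part r k m)" "ordered m"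
  shows "\<exists>w. has_type w (\<lambda>k. part r k m) \<and> lookup (monval (gram t :: _ \<Rightarrow> 'k::comm_ring_1 mpoly) m) w = 1"
  using assms
proof (induction m rule: mono_induct)
  case zero
  have "part r k 0 = 0" for k by (simp add: part_def)
  then show ?case by (intro exI[of _ 0]) (auto simp: has_type_def)
next
  case (add m v)
  let ?q = "monval (gram t :: _ \<Rightarrow> 'k mpoly) m"
  let ?m' = "m + Poly_Mapping.single v 1"
  have "\<exists>w. has_type w (\<lambda>k. part r k m) \<and> lookup ?q w = 1"
  proof (rule add.IH)
    show "nested (part r k m)" for k
      using add.prems(2)[of k] unfolding part_add nested_def keys_add_nat by blast
  qed (use add.prems in \<open>auto simp: keys_add_nat ordered_def\<close>)
  then obtain w where w: "has_type w (\<lambda>k. part r k m)" "lookup ?q w = 1" by blast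
  have rv: "r v < t" using add.prems(1)[of v] by (simp add: keys_add_nat)
  let ?w = "yquad (r v) v + w"
  have w': "has_type ?w (\<lambda>k. part r k ?m')"
    using w(1) unfolding has_type_def lookup_add lookup_yquad part_add part_single
    by (auto simp: content_add)
  have zero: "lookup (Poly_Mapping.single (yquad k v) 1 * ?q) ?w = 0" if k: "k < t" "k \<noteq> r v" for k
  proof (rule ccontr)
    assume "\<not> ?thesis"
    then have "?w \<in> keys (Poly_Mapping.single (yquad k v) 1 * ?q)" by (simp add: in_keys_iff)
    then obtain w'' where w'': "?w = yquad k v + w''" "w'' \<in> keys ?q"
      using keys_mult[of "Poly_Mapping.single (yquad k v) 1" ?q] by auto
    obtain D where D: "\<forall>k\<ge>t. D k = 0" "m = (\<Sum>k<t. D k)" "has_type w'' D"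
      using keys_monval_gram[OF w''(2)] by blast
    let ?D = "D(k := D k + Poly_Mapping.single v 1)"
    have m': "?m' = (\<Sum>k<t. ?D k)"
      using k(1) by (simp add: D(2) sum.remove[of "{..<t}" k] add_ac)
    have "has_type ?w ?D"
      unfolding w'' using D(3) unfolding has_type_def lookup_add lookup_yquad by (auto simp: content_add)
    then have c: "content (?D l) = content (part r l ?m')" for l
      using w' unfolding has_type_def by (intro ext) metis
    have "?D k = part r k ?m'"
      by (rule decomposition_weight(2)[of ?m' r t ?D])
        (use add.prems m' c k in \<open>auto simp del: fun_upd_apply\<close>)
    then have "v \<in> keys (part r k ?m')"
      by (metis fun_upd_same keys_add_nat Un_iff keys_single singletonI zero_neq_one)
    then show False using k(2) by (simp add: keys_part)
  qed
  have "lookup (monval (gram t :: _ \<Rightarrow> 'k mpoly) ?m') ?w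
      = (\<Sum>k<t. lookup (Poly_Mapping.single (yquad k v) 1 * ?q) ?w)"
    by (simp add: monval_add mult.commute[of ?q] gram_def[of t v] sum_distrib_right lookup_sum)
  also have "\<dots> = (\<Sum>k<t. if k = r v then 1 else 0)"
    using zero w(2) by (intro sum.cong) (auto simp: lookup_single_one_mult)
  also have "\<dots> = 1" using rv by simp
  finally show ?case using w' by blast
qed

section \<open>Chains of variables and independence\<close>

text \<open>The variables that can form the main diagonal of an s-minor.\<close>

definition chain :: "mono \<Rightarrow> nat \<Rightarrow> (nat \<Rightarrow> nat) \<Rightarrow> (nat \<Rightarrow> nat) \<Rightarrow> bool" where
  "chain m s a b \<longleftrightarrow> (\<forall>i<s. (a i, b i) \<in> keys m) \<and> (\<forall>i j. i < j \<and> j < s \<longrightarrow> a i < a j \<and> b i < b j)"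

definition chainfree :: "nat \<Rightarrow> mono \<Rightarrow> bool" where
  "chainfree s m \<longleftrightarrow> \<not> (\<exists>a b. chain m s a b)"

lemma chain_mono: "chain m s a b \<Longrightarrow> s' \<le> s \<Longrightarrow> chain m s' a b"
  by (auto simp: chain_def)

lemma chain_append:
  assumes "chain m s a b" "v \<in> keys m" "\<And>i. i < s \<Longrightarrow> a i < fst v \<and> b i < snd v"
  shows "chain m (Suc s) (a(s := fst v)) (b(s := snd v))"
  using assms by (auto simp: chain_def less_Suc_eq)

text \<open>Let \<open>r v\<close> be the length of the longest chain strictly below
  \<open>v\<close>. It increases strictly along chains, so variables of equal rank are never
  strictly comparable and the classes are nested; a value \<open>t\<close> or more would give a
  chain of length \<open>Suc t\<close>.\<close>

lemma chainfree_rank: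
  assumes "chainfree (Suc t) m"
  shows "\<exists>r. (\<forall>v\<in>keys m. r v < t) \<and> (\<forall>k. nested (part r k m))"
proof -
  define S where "S v = {s. \<exists>a b. chain m s a b \<and> (\<forall>i<s. a i < fst v \<and> b i < snd v)}" for v
  define r where "r v = Max (S v)" for v
  have S0: "0 \<in> S v" for v by (auto simp: S_def chain_def)
  have lt: "s < t" if sv: "s \<in> S v" "v \<in> keys m" for s v
  proof (rule ccontr)
    assume "\<not> s < t"
    obtain a b where "chain m s a b" "\<forall>i<s. a i < fst v \<and> b i < snd v"
      using sv(1) unfolding S_def by blast
    then have "chain m (Suc s) (a(s := fst v)) (b(s := snd v))" using sv(2) by (auto intro: chain_append)
    then have "chain m (Suc t) (a(s := fst v)) (b(s := snd v))" using \<open>\<not> s < t\<close> by (auto intro: chain_mono)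
    then show False using assms by (auto simp: chainfree_def)
  qed
  have fin: "finite (S v)" if "v \<in> keys m" for v
    using lt[OF _ that] by (intro finite_subset[of "S v" "{..<t}"]) auto
  have rS: "r v \<in> S v" if "v \<in> keys m" for v
    unfolding r_def using S0[of v] fin[OF that] by (intro Max_in) blast+
  have "r u < r v" if uv: "u \<in> keys m" "v \<in> keys m" "fst u < fst v" "snd u < snd v" for u v
  proof -
    obtain a b where ab: "chain m (r u) a b" "\<forall>i<r u. a i < fst u \<and> b i < snd u"
      using rS[OF uv(1)] by (auto simp: S_def)
    then have "chain m (Suc (r u)) (a(r u := fst u)) (b(r u := snd u))" using uv by (auto intro: chain_append)
    moreover have "\<forall>i<Suc (r u). (a(r u := fst u)) i < fst v \<and> (b(r u := snd u)) i < snd v"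
      using ab(2) uv by (auto simp: less_Suc_eq intro: less_trans)
    ultimately have "Suc (r u) \<in> S v" unfolding S_def by blast
    then show ?thesis using fin[OF uv(2)] unfolding r_def[of v] by (simp add: Suc_le_lessD)
  qed
  then have "nested (part r k m)" for k
    unfolding nested_def keys_part by fastforce
  then show ?thesis using rS lt by blast
qed

text \<open>Take the heaviest monomial \<open>m\<close> of \<open>h\<close> and its distinguished
  image \<open>w\<close>. Any other monomial producing \<open>w\<close> decomposes with the same
  contents, so it is at least as heavy as \<open>m\<close>, hence equally heavy, hence
  \<open>m\<close> itself. The coefficient of \<open>m\<close> survives.\<close>

lemma chainfree_independent:
  fixes h :: "'k::comm_ring_1 mpoly"
  assumes ok: "\<And>m. m \<in> keys h \<Longrightarrow> ordered m \<and> chainfree (Suc t) m" and "ev t h = 0"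
  shows "h = 0"
proof (rule ccontr)
  assume "h \<noteq> 0"
  then have ne: "wsum wt ` keys h \<noteq> {}" by simp
  then have "Max (wsum wt ` keys h) \<in> wsum wt ` keys h" by (intro Max_in) auto
  then obtain m where m: "m \<in> keys h" "wsum wt m = Max (wsum wt ` keys h)" by auto
  have max: "wsum wt m' \<le> wsum wt m" if "m' \<in> keys h" for m' using m(2) that by simp
  obtain r where r: "\<And>v. v \<in> keys m \<Longrightarrow> r v < t" "\<And>k. nested (part r k m)"
    using chainfree_rank[of t m] ok[OF m(1)] by blast
  obtain w where w: "has_type w (\<lambda>k. part r k m)" "lookup (monval (gram t :: _ \<Rightarrow> 'k mpoly) m) w = 1"
    using coefficient_monval_gram[of m r t] r ok[OF m(1)] by blast
  have zero: "lookup (monval (gram t :: _ \<Rightarrow> 'k mpoly) m') w = 0" if m': "m' \<in> keys h" "m' \<noteq> m" for m'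
  proof (rule ccontr)
    assume "\<not> ?thesis"
    then obtain D where D: "m' = (\<Sum>k<t. D k)" "has_type w D"
      using keys_monval_gram[of w t m', where 'k='k] by (auto simp: in_keys_iff)
    have c: "content (D l) = content (part r l m)" for l
      using D(2) w(1) unfolding has_type_def by (intro ext) metis
    note dw = decomposition_weight[of m r t D, OF r(1) r(2) _ _ c]
    have om: "ordered m" "ordered (\<Sum>k<t. D k)" using ok m(1) m'(1) D(1) by auto
    have "wsum wt m \<le> wsum wt m'" using dw(1) om D(1) by simp
    then have eq: "wsum wt m = wsum wt (\<Sum>k<t. D k)" using max[OF m'(1)] D(1) by simp
    have "m' = (\<Sum>k<t. part r k m)"
      unfolding D(1) using dw(2)[OF _ om eq] by (intro sum.cong refl) simp
    then show False using sum_part[of m r t] r m'(2) by simp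
  qed
  have "lookup (ev t h) w = (\<Sum>m'\<in>keys h. lookup h m' * lookup (monval (gram t) m') w)"
    unfolding subst_def lookup_sum
    by (intro sum.cong) (auto simp: lookup_single_mult_add[of 0, simplified])
  also have "\<dots> = (\<Sum>m'\<in>keys h. if m' = m then lookup h m else 0)"
    using zero w(2) by (intro sum.cong) auto
  also have "\<dots> = lookup h m" using m(1) by simp
  finally show False using assms(2) m(1) by (simp add: in_keys_iff)
qed

section \<open>The determinantal ideal as a kernel\<close>

lemma sym_poly_ring_simps [simp]:
  "x \<otimes>\<^bsub>sym_poly_ring n\<^esub> y = x * y" "x \<oplus>\<^bsub>sym_poly_ring n\<^esub> y = x + y"
  "\<one>\<^bsub>sym_poly_ring n\<^esub> = 1" "\<zero>\<^bsub>sym_poly_ring n\<^esub> = 0"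
  by (simp_all add: sym_poly_ring_def)

lemma cring_sym_poly_ring: "cring (sym_poly_ring n :: 'k::comm_ring_1 mpoly ring)"
proof (rule cringI)
  show "abelian_group (sym_poly_ring n :: 'k mpoly ring)"
  proof (rule abelian_groupI)
    fix x :: "'k mpoly" assume "x \<in> carrier (sym_poly_ring n)"
    then show "\<exists>y\<in>carrier (sym_poly_ring n). y \<oplus>\<^bsub>sym_poly_ring n\<^esub> x = \<zero>\<^bsub>sym_poly_ring n\<^esub>"
      by (intro bexI[of _ "- x"]) (auto simp: carrier_sym_poly_ring polys_uminus)
  qed (auto simp: carrier_sym_poly_ring add_ac intro: polys_add)
  show "Group.comm_monoid (sym_poly_ring n :: 'k mpoly ring)"
    by (rule comm_monoidI) (auto simp: carrier_sym_poly_ring mult_ac intro: polys_mult)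
qed (auto simp: distrib_right)

lemma nat_pow_sym_poly_ring:
  "(x :: 'k::comm_ring_1 mpoly) [^]\<^bsub>sym_poly_ring n\<^esub> (k::nat) = x ^ k"
proof -
  interpret cring "sym_poly_ring n :: 'k mpoly ring" by (rule cring_sym_poly_ring)
  show ?thesis by (induction k) (auto simp: mult.commute)
qed

lemma xvar_polys: "i < n \<Longrightarrow> j < n \<Longrightarrow> xvar i j \<in> polys (sym_vars n)"
  by (auto simp: xvar_def sym_vars_def intro!: polys_single)

lemma submatrix_symX:
  assumes "I \<subseteq> {..<n}" "J \<subseteq> {..<n}" "card I = r" "card J = r"
  shows "submatrix (symX n) I J = mat r r (\<lambda>(i, j). xvar (pick I i) (pick J j))"
    and "\<And>i. i < r \<Longrightarrow> pick I i < n" "\<And>j. j < r \<Longrightarrow> pick J j < n"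
proof -
  have *: "{i. i < n \<and> i \<in> I} = I" "{i. i < n \<and> i \<in> J} = J" using assms by auto
  show p: "\<And>i. i < r \<Longrightarrow> pick I i < n" "\<And>j. j < r \<Longrightarrow> pick J j < n"
    using pick_le[of _ n I] pick_le[of _ n J] assms * by auto
  show "submatrix (symX n) I J = mat r r (\<lambda>(i, j). xvar (pick I i) (pick J j))"
    by (rule eq_matI) (auto simp: submatrix_def symX_def * assms p)
qed

lemma minors_polys: "(minors n r :: 'a::comm_ring_1 mpoly set) \<subseteq> polys (sym_vars n)"
proof
  fix d :: "'a mpoly" assume "d \<in> minors n r"
  then obtain I J where IJ: "I \<subseteq> {..<n}" "J \<subseteq> {..<n}" "card I = r" "card J = r"
    and d: "d = det (submatrix (symX n) I J)"
    unfolding minors_def by blast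
  show "d \<in> polys (sym_vars n)"
    unfolding d submatrix_symX(1)[OF IJ]
    by (rule polys_det[of _ r]) (auto intro!: xvar_polys simp: submatrix_symX(2,3)[OF IJ])
qed

text \<open>Passes from minors given by index sets to minors given by strictly increasing
  sequences.\<close>

lemma pick_strict_mono:
  assumes "\<And>i j. i < j \<Longrightarrow> j < r \<Longrightarrow> a i < (a j :: nat)" "i < r"
  shows "pick (a ` {..<r}) i = a i" "card (a ` {..<r}) = r"
proof -
  have lt: "a i < a j \<longleftrightarrow> i < j" if "i < r" "j < r" for i j
    using assms(1)[of i j] assms(1)[of j i] that by (metis less_irrefl not_less_iff_gr_or_eq order.strict_trans)
  have inj: "inj_on a {..<r}"
  proof (rule inj_onI)
    fix i j assume "i \<in> {..<r}" "j \<in> {..<r}" "a i = a j"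
    then show "i = j" using lt[of i j] lt[of j i] by (cases i j rule: linorder_cases) auto
  qed
  then show "card (a ` {..<r}) = r" by (simp add: card_image)
  have "{x \<in> a ` {..<r}. x < a i} = a ` {..<i}" using lt assms(2) by auto
  moreover have "card (a ` {..<i}) = i"
    using inj assms(2) by (subst card_image) (auto intro: inj_on_subset)
  ultimately show "pick (a ` {..<r}) i = a i"
    using pick_card_in_set[of "a i" "a ` {..<r}"] assms(2) by auto
qed

lemma minor_mem:
  assumes "\<And>i j. i < j \<Longrightarrow> j < r \<Longrightarrow> a i < a j" "\<And>i j. i < j \<Longrightarrow> j < r \<Longrightarrow> b i < b j"
    and "\<And>i. i < r \<Longrightarrow> a i < n \<and> b i < n"
  shows "det (mat r r (\<lambda>(i, j). xvar (a i) (b j)) :: 'k::comm_ring_1 mpoly mat) \<in> minors n r"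
proof -
  let ?I = "a ` {..<r}" and ?J = "b ` {..<r}"
  have c: "card ?I = r" "card ?J = r"
    using pick_strict_mono(2)[of r a 0] pick_strict_mono(2)[of r b 0] assms by (cases "r = 0"; auto)+
  have sub: "?I \<subseteq> {..<n}" "?J \<subseteq> {..<n}" using assms(3) by auto
  have "mat r r (\<lambda>(i, j). xvar (a i) (b j) :: 'k mpoly) = submatrix (symX n) ?I ?J"
    unfolding submatrix_symX(1)[OF sub c]
    by (rule eq_matI) (auto simp: pick_strict_mono(1)[of r a] pick_strict_mono(1)[of r b] assms)
  then have "det (mat r r (\<lambda>(i, j). xvar (a i) (b j) :: 'k mpoly)) = det (submatrix (symX n) ?I ?J)" by simp
  then show ?thesis unfolding minors_def using sub c by blast
qed

lemma det_ideal_ideal: "ideal (det_ideal n r :: 'k::comm_ring_1 mpoly set) (sym_poly_ring n)"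
proof -
  interpret cring "sym_poly_ring n :: 'k mpoly ring" by (rule cring_sym_poly_ring)
  show ?thesis unfolding det_ideal_def
    by (rule genideal_ideal) (simp add: carrier_sym_poly_ring minors_polys)
qed

lemma det_ideal_polys: "det_ideal n r \<subseteq> polys (sym_vars n)"
  using ideal.axioms(1)[OF det_ideal_ideal] additive_subgroup.a_subset carrier_sym_poly_ring by metis

lemma det_ideal_minors: "minors n r \<subseteq> (det_ideal n r :: 'k::comm_ring_1 mpoly set)"
proof -
  interpret cring "sym_poly_ring n :: 'k mpoly ring" by (rule cring_sym_poly_ring)
  show ?thesis unfolding det_ideal_def
    by (rule genideal_self) (simp add: carrier_sym_poly_ring minors_polys)
qed

lemma det_ideal_0: "0 \<in> det_ideal n r"
  using additive_subgroup.zero_closed[OF ideal.axioms(1)[OF det_ideal_ideal[of n r]]] by simp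

lemma det_ideal_add: "x \<in> det_ideal n r \<Longrightarrow> y \<in> det_ideal n r \<Longrightarrow> x + y \<in> det_ideal n r"
  using additive_subgroup.a_closed[OF ideal.axioms(1)[OF det_ideal_ideal[of n r]]] by simp

lemma det_ideal_mult: "x \<in> polys (sym_vars n) \<Longrightarrow> y \<in> det_ideal n r \<Longrightarrow> x * y \<in> det_ideal n r"
  using ideal.I_l_closed[OF det_ideal_ideal[of n r]] by (simp add: carrier_sym_poly_ring)

section \<open>Vanishing of the minors on Gram matrices\<close>

definition yvar :: "nat \<Rightarrow> nat \<Rightarrow> 'k::comm_ring_1 mpoly" where
  "yvar k i = Poly_Mapping.single (Poly_Mapping.single (k, i) 1) 1"

lemma ev_xvar: "ev t (xvar i j) = (\<Sum>k<t. yvar k i * yvar k j)"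
  unfolding xvar_def subst_single monval_single
  by (auto simp: gram_def yvar_def mult_single yquad_def min_def max_def add.commute intro!: sum.cong)

lemma ev_det: "ev t (det A) = det (map_mat (ev t) A)"
  by simp

lemma ev_minor_mat:
  "ev t (det (mat r s (\<lambda>(i, j). xvar (a i) (b j)))) = det (mat r s (\<lambda>(i, j). \<Sum>k<t. yvar k (a i) * yvar k (b j)))"
  unfolding ev_det by (rule arg_cong[of _ _ det], rule eq_matI) (auto simp: ev_xvar)

lemma ev_minors:
  assumes "d \<in> minors n (Suc t)" shows "ev t (d :: 'k::idom mpoly) = 0"
proof -
  obtain I J where IJ: "I \<subseteq> {..<n}" "J \<subseteq> {..<n}" "card I = Suc t" "card J = Suc t"
    and d: "d = det (submatrix (symX n) I J)"
    using assms by (auto simp: minors_def)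
  show ?thesis unfolding d submatrix_symX(1)[OF IJ] ev_minor_mat
    by (rule det_rank_less[of t "Suc t" "\<lambda>i k. yvar k (pick I i)" "\<lambda>k j. yvar k (pick J j)"]) simp
qed

lemma det_ideal_ev:
  assumes "p \<in> det_ideal n (Suc t)" shows "ev t (p :: 'k::idom mpoly) = 0"
proof -
  interpret cring "sym_poly_ring n :: 'k mpoly ring" by (rule cring_sym_poly_ring)
  let ?K = "{p \<in> polys (sym_vars n). ev t (p :: 'k mpoly) = 0}"
  have "ideal ?K (sym_poly_ring n)"
  proof (rule idealI)
    show "subgroup ?K (add_monoid (sym_poly_ring n))"
    proof (rule add.subgroupI)
      fix a :: "'k mpoly" assume a: "a \<in> ?K"
      have "\<ominus>\<^bsub>sym_poly_ring n\<^esub> a = - a"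
        using a by (intro sum_zero_eq_neg[symmetric]) (auto simp: carrier_sym_poly_ring polys_uminus)
      then show "\<ominus>\<^bsub>sym_poly_ring n\<^esub> a \<in> ?K"
        using a by (auto simp: polys_uminus subst.hom_uminus)
    qed (auto simp: carrier_sym_poly_ring subst_add polys_add intro: exI[of _ 0])
  qed (auto simp: carrier_sym_poly_ring subst_mult polys_mult intro: ring_axioms)
  then have "det_ideal n (Suc t) \<subseteq> ?K"
    unfolding det_ideal_def using minors_polys ev_minors by (intro genideal_minimal) auto
  then show ?thesis using assms by auto
qed

section \<open>Straightening modulo the ideal\<close>

text \<open>The pairs of a chain are distinct, so their product is squarefree and divides
  \<open>m\<close>. The condition \<open>a i \<le> b i\<close> makes
  \<open>xmono (a i) (b i)\<close> the variable with key \<open>(a i, b i)\<close>.\<close>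

lemma chain_divides:
  assumes "chain m s a b" "\<And>i. i < s \<Longrightarrow> a i \<le> b i"
  shows "m = (m - (\<Sum>i<s. xmono (a i) (b i))) + (\<Sum>i<s. xmono (a i) (b i))"
proof (rule poly_mapping_eqI)
  fix v
  have "lookup (\<Sum>i<s. xmono (a i) (b i)) v = (\<Sum>i<s. of_bool ((a i, b i) = v))"
    unfolding lookup_sum by (rule sum.cong) (auto simp: xmono_def assms(2) lookup_single when_def)
  also have "\<dots> = card {i\<in>{..<s}. (a i, b i) = v}"
    by (simp add: of_bool_def sum.If_cases Int_def)
  also have "\<dots> \<le> lookup m v"
  proof (cases "\<exists>i<s. (a i, b i) = v")
    case True
    then obtain i where i: "i < s" "(a i, b i) = v" by blast
    then have "{i\<in>{..<s}. (a i, b i) = v} \<subseteq> {i}"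
      using assms(1) unfolding chain_def by (auto; metis nat_neq_iff less_irrefl)
    then have "card {i\<in>{..<s}. (a i, b i) = v} \<le> 1"
      using card_mono[of "{i}"] by fastforce
    also have "1 \<le> lookup m v" using assms(1) i unfolding chain_def
      by (metis One_nat_def Suc_leI in_keys_iff neq0_conv)
    finally show ?thesis .
  next
    case False
    then have "{i\<in>{..<s}. (a i, b i) = v} = {}" by auto
    then show ?thesis by (simp only: card.empty le0)
  qed
  finally show "lookup m v = lookup (m - (\<Sum>i<s. xmono (a i) (b i)) + (\<Sum>i<s. xmono (a i) (b i))) v"
    by (simp add: lookup_add lookup_minus)
qed

definition reducible :: "nat \<Rightarrow> nat \<Rightarrow> 'k::comm_ring_1 mpoly \<Rightarrow> bool" where
  "reducible n s p \<longleftrightarrow> (\<exists>q\<in>polys (sym_vars n). (\<forall>m\<in>keys q. chainfree s m) \<and> p - q \<in> det_ideal n s)"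

lemma reducible_add: "reducible n s p \<Longrightarrow> reducible n s p' \<Longrightarrow> reducible n s (p + p')"
  unfolding reducible_def
proof safe
  fix q q' assume *: "q \<in> polys (sym_vars n)" "q' \<in> polys (sym_vars n)" "\<forall>m\<in>keys q. chainfree s m"
    "\<forall>m\<in>keys q'. chainfree s m" "p - q \<in> det_ideal n s" "p' - q' \<in> det_ideal n s"
  have "(p - q) + (p' - q') \<in> det_ideal n s" using * by (intro det_ideal_add)
  moreover have "\<forall>m\<in>keys (q + q'). chainfree s m" using keys_add[of q q'] * by blast
  ultimately show "\<exists>q\<in>polys (sym_vars n). (\<forall>m\<in>keys q. chainfree s m) \<and> p + p' - q \<in> det_ideal n s"
    using * by (intro bexI[of _ "q + q'"]) (auto simp: polys_add algebra_simps)
qed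

lemma reducible_scale:
  assumes "reducible n s p" shows "reducible n s (Poly_Mapping.single 0 c * p)"
proof -
  obtain q where *: "q \<in> polys (sym_vars n)" "\<forall>m\<in>keys q. chainfree s m" "p - q \<in> det_ideal n s"
    using assms by (auto simp: reducible_def)
  have "keys (Poly_Mapping.single 0 c * q) \<subseteq> keys q"
    using keys_mult[of "Poly_Mapping.single 0 c" q] by (auto split: if_splits)
  moreover have "Poly_Mapping.single 0 c * (p - q) \<in> det_ideal n s"
    using * by (intro det_ideal_mult polys_single) auto
  ultimately show ?thesis unfolding reducible_def using *
    by (intro bexI[of _ "Poly_Mapping.single 0 c * q"]) (auto simp: right_diff_distrib intro!: polys_mult polys_single)
qed

lemma reducible_sum: "(\<And>i. i \<in> A \<Longrightarrow> reducible n s (f i)) \<Longrightarrow> reducible n s (sum f A)"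
proof (induction A rule: infinite_finite_induct)
  case empty
  then show ?case by (auto simp: reducible_def det_ideal_0 intro!: bexI[of _ 0])
next
  case (infinite A)
  then show ?case by (auto simp: reducible_def det_ideal_0 intro!: bexI[of _ 0])
qed (auto intro: reducible_add)

lemma reducible_det_ideal: "p \<in> det_ideal n s \<Longrightarrow> reducible n s p"
  by (auto simp: reducible_def intro!: bexI[of _ 0])

lemma reducible_poly:
  fixes p :: "'k::comm_ring_1 mpoly"
  assumes "\<And>m. m \<in> keys p \<Longrightarrow> reducible n s (Poly_Mapping.single m (1::'k))"
  shows "reducible n s p"
proof -
  have "reducible n s (\<Sum>m\<in>keys p. Poly_Mapping.single 0 (lookup p m) * Poly_Mapping.single m (1::'k))"
    by (rule reducible_sum, rule reducible_scale, rule assms)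
  then show ?thesis by (simp add: mult_single flip: poly_as_sum)
qed

text \<open>If \<open>m\<close> contains a chain, subtract the multiple of the corresponding minor
  with leading monomial \<open>m\<close>. Only lighter monomials remain, and induction on the weight
  applies.\<close>

lemma reducible_mono:
  assumes "keys m \<subseteq> sym_vars n"
  shows "reducible n s (Poly_Mapping.single m (1::'k::comm_ring_1))"
  using assms
proof (induction "wsum wt m" arbitrary: m rule: less_induct)
  case less
  show ?case
  proof (cases "chainfree s m")
    case True
    then show ?thesis using less.prems
      by (auto simp: reducible_def det_ideal_0 intro!: bexI[of _ "Poly_Mapping.single m 1"] polys_single)
  next
    case False
    then obtain a b where ch: "chain m s a b" by (auto simp: chainfree_def)
    then have ab: "a i \<le> b i" "b i < n" if "i < s" for i
      using less.prems that by (auto simp: chain_def sym_vars_def)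
    define \<delta> where "\<delta> = (det (mat s s (\<lambda>(i, j). xvar (a i) (b j))) :: 'k mpoly)"
    define \<mu> where "\<mu> = (\<Sum>i<s. xmono (a i) (b i))"
    define m0 where "m0 = m - \<mu>"
    have m: "m = m0 + \<mu>" unfolding m0_def \<mu>_def using ab by (intro chain_divides[OF ch]) auto
    have lead: "leads wt \<delta> \<mu>" unfolding \<delta>_def \<mu>_def using ch by (intro leads_minor) (auto simp: chain_def)
    have "\<delta> \<in> minors n s" unfolding \<delta>_def using ch ab
      by (intro minor_mem) (auto simp: chain_def intro: le_less_trans)
    then have \<delta>: "\<delta> \<in> det_ideal n s" using det_ideal_minors by blast
    have k0: "keys m0 \<subseteq> sym_vars n" using less.prems unfolding m0_def by (meson keys_minus_subset order_trans)
    define p where "p = Poly_Mapping.single m0 1 * \<delta>"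
    have p: "p \<in> det_ideal n s" unfolding p_def using \<delta> k0 by (intro det_ideal_mult polys_single)
    have "leads wt (Poly_Mapping.single m0 1 :: 'k mpoly) m0" by (auto simp: leads_def)
    then have lp: "leads wt p m" unfolding p_def m using lead by (rule leads_mult)
    define L where "L = Poly_Mapping.single m 1 - p"
    have "reducible n s L"
    proof (rule reducible_poly)
      fix k assume k: "k \<in> keys L"
      have "L \<in> polys (sym_vars n)" unfolding L_def using p det_ideal_polys less.prems
        by (intro polys_diff polys_single) auto
      then have "keys k \<subseteq> sym_vars n" using k by (auto simp: polys_def)
      moreover have "wsum wt k < wsum wt m"
        using k lp unfolding leads_def L_def
        by (auto simp: in_keys_iff lookup_minus lookup_single when_def split: if_splits)
      ultimately show "reducible n s (Poly_Mapping.single k (1::'k))" using less.hyps by blast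
    qed
    then have "reducible n s (L + p)" using reducible_add[OF _ reducible_det_ideal[OF p]] by blast
    then show ?thesis by (simp add: L_def)
  qed
qed

text \<open>Modulo the ideal an element of the kernel is a combination of chain-free monomials still
  killed by \<open>ev\<close>, and these are independent under \<open>ev\<close>.\<close>

lemma det_ideal_eq:
  "det_ideal n (Suc t) = {p \<in> polys (sym_vars n). ev t (p :: 'k::idom mpoly) = 0}"
proof (intro equalityI subsetI)
  fix p :: "'k mpoly" assume "p \<in> det_ideal n (Suc t)"
  then show "p \<in> {p \<in> polys (sym_vars n). ev t p = 0}"
    using det_ideal_ev det_ideal_polys by blast
next
  fix p :: "'k mpoly" assume p: "p \<in> {p \<in> polys (sym_vars n). ev t p = 0}"
  have "reducible n (Suc t) p"
    by (rule reducible_poly, rule reducible_mono) (use p in \<open>auto simp: polys_def\<close>)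
  then obtain q where q: "q \<in> polys (sym_vars n)" "\<forall>m\<in>keys q. chainfree (Suc t) m"
    "p - q \<in> det_ideal n (Suc t)" by (auto simp: reducible_def)
  have "ev t q = 0" using det_ideal_ev[OF q(3)] p by (simp add: subst.hom_minus)
  moreover have "ordered m" if "m \<in> keys q" for m
    using q(1) that by (fastforce simp: polys_def ordered_def sym_vars_def)
  ultimately have "q = 0" using q(2) by (intro chainfree_independent[of q t]) auto
  then show "p \<in> det_ideal n (Suc t)" using q(3) by simp
qed

section \<open>Bordered minors\<close>

lemma xvar_sym: "xvar i j = xvar j i"
  by (simp add: xvar_def min.commute max.commute)

definition corner_minor :: "nat \<Rightarrow> 'k::comm_ring_1 mpoly" where
  "corner_minor t = det (mat t t (\<lambda>(i, j). xvar i j))"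

definition bordered_mat :: "nat \<Rightarrow> nat \<Rightarrow> nat \<Rightarrow> 'k::comm_ring_1 mpoly mat" where
  "bordered_mat t i j = mat (Suc t) (Suc t) (\<lambda>(a, b). xvar (if a < t then a else i) (if b < t then b else j))"

definition bordered_minor :: "nat \<Rightarrow> nat \<Rightarrow> nat \<Rightarrow> 'k::comm_ring_1 mpoly" where
  "bordered_minor t i j = det (bordered_mat t i j)"

text \<open>The cofactors along the last row do not involve that row, so its index is set to the
  placeholder 0.\<close>

definition bordered_cofactor :: "nat \<Rightarrow> nat \<Rightarrow> nat \<Rightarrow> 'k::comm_ring_1 mpoly" where
  "bordered_cofactor t l j = cofactor (bordered_mat t 0 j) t l"

lemma bordered_mat_carrier [simp]: "bordered_mat t i j \<in> carrier_mat (Suc t) (Suc t)"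
  by (simp add: bordered_mat_def)

lemma bordered_minor_sym: "(bordered_minor t i j :: 'k::comm_ring_1 mpoly) = bordered_minor t j i"
proof -
  have "(bordered_mat t i j :: 'k mpoly mat) = transpose_mat (bordered_mat t j i)"
    by (rule eq_matI) (auto simp: bordered_mat_def xvar_sym)
  then show ?thesis by (simp add: bordered_minor_def det_transpose[of _ "Suc t"])
qed

lemma bordered_minor_eq_0: "i < t \<Longrightarrow> bordered_minor t i j = 0"
  unfolding bordered_minor_def
  by (rule det_identical_rows[of _ "Suc t" i t]) (auto simp: bordered_mat_def)

lemma bordered_minor_expand: "(bordered_minor t i j :: 'k::comm_ring_1 mpoly) = (\<Sum>l<t. xvar i l * bordered_cofactor t l j) + corner_minor t * xvar i j"
proof -
  have del: "mat_delete (bordered_mat t i j :: 'k mpoly mat) t l = mat_delete (bordered_mat t 0 j) t l" if "l \<le> t" for l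
    by (rule eq_matI) (auto simp: mat_delete_def bordered_mat_def)
  have "mat_delete (bordered_mat t i j :: 'k mpoly mat) t t = mat t t (\<lambda>(i, j). xvar i j)"
    by (rule eq_matI) (auto simp: mat_delete_def bordered_mat_def)
  then have c: "cofactor (bordered_mat t i j :: 'k mpoly mat) t t = corner_minor t"
    by (simp add: cofactor_def corner_minor_def)
  have "(bordered_minor t i j :: 'k mpoly) = (\<Sum>l<Suc t. bordered_mat t i j $$ (t, l) * cofactor (bordered_mat t i j) t l)"
    unfolding bordered_minor_def by (rule laplace_expansion_row) auto
  also have "\<dots> = (\<Sum>l<t. bordered_mat t i j $$ (t, l) * cofactor (bordered_mat t i j) t l) + xvar i j * corner_minor t"
    using c by (simp add: bordered_mat_def)
  also have "(\<Sum>l<t. (bordered_mat t i j :: 'k mpoly mat) $$ (t, l) * cofactor (bordered_mat t i j) t l) = (\<Sum>l<t. xvar i l * bordered_cofactor t l j)"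
    using del by (intro sum.cong) (auto simp: bordered_cofactor_def cofactor_def, simp add: bordered_mat_def)
  finally show ?thesis by (simp add: mult.commute)
qed

text \<open>The positions outside the first \<open>t\<close> rows and columns; their number is the
  height of the ideal.\<close>

definition bottom_vars :: "nat \<Rightarrow> nat \<Rightarrow> (nat \<times> nat) set" where
  "bottom_vars n t = {(i, j). t \<le> i \<and> i \<le> j \<and> j < n}"

definition bordered_minors :: "nat \<Rightarrow> nat \<Rightarrow> 'k::comm_ring_1 mpoly set" where
  "bordered_minors n t = (\<lambda>(i, j). bordered_minor t i j) ` bottom_vars n t"

lemma finite_bottom_vars [simp]: "finite (bottom_vars n t)"
  by (rule finite_subset[of _ "{..<n} \<times> {..<n}"]) (auto simp: bottom_vars_def)

text \<open>Enumeration by parallels \<open>d = j - i\<close> to the main diagonal. With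
  \<open>t = 0\<close> it also enumerates all the variables.\<close>

lemma bottom_vars_bij:
  "bij_betw (\<lambda>(d, i). (t + i, t + i + d)) (SIGMA d:{..<n - t}. {..<n - d - t}) (bottom_vars n t)"
  (is "bij_betw ?f ?S _")
proof (rule bij_betw_imageI)
  show "inj_on ?f ?S" by (auto simp: inj_on_def)
  show "?f ` ?S = bottom_vars n t"
  proof safe
    fix i j assume "(i, j) \<in> bottom_vars n t"
    then have "(j - i, i - t) \<in> ?S" "(i, j) = ?f (j - i, i - t)"
      by (auto simp: bottom_vars_def)
    then show "(i, j) \<in> ?f ` ?S" by (rule rev_image_eqI)
  qed (auto simp: bottom_vars_def)
qed

lemma card_bottom_vars: "card (bottom_vars n t) = (\<Sum>d<n - t. n - d - t)"
  using bij_betw_same_card[OF bottom_vars_bij[of t n]] by simp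

lemma bordered_minors_bordered_minor: "i < n \<Longrightarrow> j < n \<Longrightarrow> bordered_minor t i j \<in> idl (bordered_minors n t)"
proof -
  have *: "bordered_minor t i j \<in> idl (bordered_minors n t)" if "i \<le> j" "j < n" for i j
  proof (cases "i < t")
    case False
    then have "(i, j) \<in> bottom_vars n t" using that by (auto simp: bottom_vars_def)
    then show ?thesis unfolding bordered_minors_def by (intro idl_base) (rule image_eqI[of _ _ "(i, j)"], auto)
  qed (simp add: bordered_minor_eq_0)
  assume "i < n" "j < n"
  then show ?thesis using *[of i j] *[of j i] bordered_minor_sym[of t i j] by (metis nat_le_linear)
qed

text \<open>By \<open>bordered_minor_expand\<close>, multiplying the matrix by
  \<open>corner_minor t\<close> gives one that factors through size \<open>t\<close> plus a matrix
  of bordered minors. The exponent \<open>s\<close> comes from taking the scalar out of the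
  determinant.\<close>

lemma minor_ipow:
  fixes a b :: "nat \<Rightarrow> nat"
  assumes "\<And>i. i < s \<Longrightarrow> a i < n" "\<And>i. i < s \<Longrightarrow> b i < n"
  shows "corner_minor t ^ s * det (mat s s (\<lambda>(i, j). xvar (a i) (b j))) \<in> (ipow (bordered_minors n t) (s - t) :: 'k::idom mpoly set)"
proof -
  let ?A = "mat s s (\<lambda>(i, j). xvar (a i) (b j)) :: 'k mpoly mat"
  have "corner_minor t \<cdot>\<^sub>m ?A = mat s s (\<lambda>(i, j). (\<Sum>l<t. xvar (a i) l * (- bordered_cofactor t l (b j))) + bordered_minor t (a i) (b j))"
    by (rule eq_matI) (auto simp: bordered_minor_expand sum_negf)
  moreover have "det (corner_minor t \<cdot>\<^sub>m ?A) = corner_minor t ^ s * det ?A" by simp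
  ultimately show ?thesis
    using det_UV_plus_E[where s = s and t = t and e = "\<lambda>i j. bordered_minor t (a i) (b j)" and G = "bordered_minors n t :: 'k mpoly set"
        and u = "\<lambda>i l. xvar (a i) l" and v = "\<lambda>l j. - bordered_cofactor t l (b j)"] bordered_minors_bordered_minor assms
    by metis
qed

section \<open>Eliminating the bottom variables\<close>

definition top_vars :: "nat \<Rightarrow> nat \<Rightarrow> (nat \<times> nat) set" where
  "top_vars n t = {(i, j). i \<le> j \<and> j < n \<and> i < t}"

lemma polys_mono: "V \<subseteq> W \<Longrightarrow> polys V \<subseteq> polys W"
  by (auto simp: polys_def)

lemma top_vars_sym_vars: "top_vars n t \<subseteq> sym_vars n"
  by (auto simp: top_vars_def sym_vars_def)

lemma xvar_top: "i < n \<Longrightarrow> j < n \<Longrightarrow> i < t \<or> j < t \<Longrightarrow> xvar i j \<in> polys (top_vars n t)"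
  by (auto simp: xvar_def top_vars_def intro!: polys_single)

lemma corner_minor_top: "t \<le> n \<Longrightarrow> corner_minor t \<in> polys (top_vars n t)"
  unfolding corner_minor_def by (rule polys_det) (auto intro!: xvar_top)

lemma bordered_cofactor_top: "t < n \<Longrightarrow> j < n \<Longrightarrow> l < t \<Longrightarrow> bordered_cofactor t l j \<in> polys (top_vars n t)"
proof -
  assume *: "t < n" "j < n" "l < t"
  have "det (mat_delete (bordered_mat t 0 j) t l) \<in> polys (top_vars n t)"
    by (rule polys_det[of _ t]) (use * in \<open>auto simp: mat_delete_def bordered_mat_def intro!: xvar_top\<close>)
  moreover have "(- 1) ^ (t + l) \<in> polys (top_vars n t)"
    by (intro polys_power polys_uminus polys_1)
  ultimately show ?thesis unfolding bordered_cofactor_def cofactor_def by (intro polys_mult)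
qed

text \<open>A denominator-free form of: with \<open>corner_minor t\<close> inverted and modulo the
  bordered minors, \<open>c\<close> becomes a polynomial in the first \<open>t\<close> rows.\<close>

definition top_reducible :: "nat \<Rightarrow> nat \<Rightarrow> 'k::comm_ring_1 mpoly \<Rightarrow> bool" where
  "top_reducible n t c \<longleftrightarrow> (\<exists>M. \<exists>c'\<in>polys (top_vars n t). corner_minor t ^ M * c - c' \<in> idl (bordered_minors n t))"

lemma top_reducible_top: "c \<in> polys (top_vars n t) \<Longrightarrow> top_reducible n t c"
  unfolding top_reducible_def by (rule exI[of _ 0], rule bexI[of _ c]) auto

lemma top_reducible_add:
  assumes "t < n" "top_reducible n t c" "top_reducible n t d"
  shows "top_reducible n t (c + d)"
proof -
  obtain M c' N d' where *: "c' \<in> polys (top_vars n t)" "corner_minor t ^ M * c - c' \<in> idl (bordered_minors n t)"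
    "d' \<in> polys (top_vars n t)" "corner_minor t ^ N * d - d' \<in> idl (bordered_minors n t)"
    using assms by (auto simp: top_reducible_def)
  have "corner_minor t ^ N * (corner_minor t ^ M * c - c') + corner_minor t ^ M * (corner_minor t ^ N * d - d') \<in> idl (bordered_minors n t)"
    using * by (intro idl_add idl_mult)
  moreover have "corner_minor t ^ N * (corner_minor t ^ M * c - c') + corner_minor t ^ M * (corner_minor t ^ N * d - d')
     = corner_minor t ^ (M + N) * (c + d) - (corner_minor t ^ N * c' + corner_minor t ^ M * d')"
    by (simp add: algebra_simps power_add)
  moreover have "corner_minor t ^ N * c' + corner_minor t ^ M * d' \<in> polys (top_vars n t)"
    using * assms(1) by (intro polys_add polys_mult polys_power corner_minor_top) auto
  ultimately show ?thesis unfolding top_reducible_def by metis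
qed

lemma top_reducible_mult:
  assumes "t < n" "top_reducible n t c" "top_reducible n t d"
  shows "top_reducible n t (c * d)"
proof -
  obtain M c' N d' where *: "c' \<in> polys (top_vars n t)" "corner_minor t ^ M * c - c' \<in> idl (bordered_minors n t)"
    "d' \<in> polys (top_vars n t)" "corner_minor t ^ N * d - d' \<in> idl (bordered_minors n t)"
    using assms by (auto simp: top_reducible_def)
  have "(corner_minor t ^ N * d) * (corner_minor t ^ M * c - c') + c' * (corner_minor t ^ N * d - d') \<in> idl (bordered_minors n t)"
    using * by (intro idl_add idl_mult)
  moreover have "(corner_minor t ^ N * d) * (corner_minor t ^ M * c - c') + c' * (corner_minor t ^ N * d - d')
     = corner_minor t ^ (M + N) * (c * d) - c' * d'"
    by (simp add: algebra_simps power_add)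
  ultimately show ?thesis unfolding top_reducible_def using * polys_mult by metis
qed

lemma top_reducible_xvar:
  assumes "t < n" "i \<le> j" "j < n"
  shows "top_reducible n t (xvar i j :: 'k::comm_ring_1 mpoly)"
proof (cases "i < t")
  case True
  then show ?thesis using assms by (intro top_reducible_top xvar_top) auto
next
  case False
  \<comment> \<open>A bordered minor solves for \<open>corner_minor t * xvar i j\<close> in terms of
    top variables.\<close>
  let ?c = "- (\<Sum>l<t. xvar i l * bordered_cofactor t l j) :: 'k mpoly"
  have "?c \<in> polys (top_vars n t)"
    using assms by (intro polys_uminus polys_sum polys_mult xvar_top bordered_cofactor_top) auto
  moreover have "corner_minor t ^ 1 * xvar i j - ?c \<in> idl (bordered_minors n t)"
    using bordered_minors_bordered_minor[of i n j t] assms by (simp add: bordered_minor_expand add.commute)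
  ultimately show ?thesis unfolding top_reducible_def by blast
qed

lemma top_reducible_polys:
  assumes "t < n" "c \<in> polys (sym_vars n)"
  shows "top_reducible n t (c :: 'k::comm_ring_1 mpoly)"
proof -
  have mono: "top_reducible n t (Poly_Mapping.single m (1::'k))" if "keys m \<subseteq> sym_vars n" for m
    using that
  proof (induction m rule: mono_induct)
    case zero
    show ?case by (intro top_reducible_top polys_single) auto
  next
    case (add m v)
    have v: "v \<in> sym_vars n" "keys m \<subseteq> sym_vars n" using add.prems by (auto simp: keys_add_nat)
    then have "xvar (fst v) (snd v) = Poly_Mapping.single (Poly_Mapping.single v 1) (1::'k)"
      by (auto simp: xvar_def sym_vars_def)
    moreover have "top_reducible n t (Poly_Mapping.single m 1 * xvar (fst v) (snd v) :: 'k mpoly)"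
      using assms(1) add.IH v by (intro top_reducible_mult top_reducible_xvar) (auto simp: sym_vars_def)
    ultimately show ?case by (simp add: mult_single)
  qed
  have "top_reducible n t (\<Sum>m\<in>A. Poly_Mapping.single m (lookup c m))" if "finite A" "A \<subseteq> keys c" for A
    using that
  proof (induction A rule: finite_induct)
    case empty
    show ?case by (intro top_reducible_top) auto
  next
    case (insert m A)
    have "top_reducible n t (Poly_Mapping.single 0 (lookup c m) * Poly_Mapping.single m (1::'k))"
      using assms insert.prems
      by (intro top_reducible_mult top_reducible_top polys_single mono) (auto simp: polys_def)
    then show ?case using insert assms(1) by (simp add: mult_single top_reducible_add)
  qed
  from this[of "keys c"] show ?thesis by (simp flip: poly_as_sum)
qed

text \<open>In a chain of length \<open>Suc t\<close> the last row index is at least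
  \<open>t\<close>, so top variables alone contain no such chain.\<close>

lemma top_independent:
  fixes p :: "'k::comm_ring_1 mpoly"
  assumes "p \<in> polys (top_vars n t)" "ev t p = 0"
  shows "p = 0"
proof (rule chainfree_independent[of p t])
  fix m assume m: "m \<in> keys p"
  then have k: "keys m \<subseteq> top_vars n t" using assms(1) by (auto simp: polys_def)
  have "False" if "chain m (Suc t) a b" for a b
  proof -
    have "i \<le> a i" if "i \<le> t" for i
      using that
    proof (induction i)
      case (Suc i)
      then have "a i < a (Suc i)" using \<open>chain m (Suc t) a b\<close> by (auto simp: chain_def)
      then show ?case using Suc by auto
    qed simp
    moreover have "(a t, b t) \<in> top_vars n t" using that k by (auto simp: chain_def)
    ultimately show False by (fastforce simp: top_vars_def)
  qed
  then show "ordered m \<and> chainfree (Suc t) m"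
    using k by (fastforce simp: chainfree_def ordered_def top_vars_def)
qed fact

lemma ev_corner_minor: "t < n \<Longrightarrow> ev t (corner_minor t :: 'k::idom mpoly) \<noteq> 0"
proof
  assume "t < n" "ev t (corner_minor t :: 'k mpoly) = 0"
  then have "(corner_minor t :: 'k mpoly) = 0" using top_independent[of "corner_minor t :: 'k mpoly" n t] corner_minor_top[of t n] by simp
  moreover have "leads wt (corner_minor t :: 'k mpoly) (\<Sum>i<t. xmono i i)"
    unfolding corner_minor_def using leads_minor[of t "\<lambda>i. i" "\<lambda>i. i"] by simp
  ultimately show False by (simp add: leads_def)
qed

lemma ev_bordered_minor: "ev t (bordered_minor t i j :: 'k::idom mpoly) = 0"
  unfolding bordered_minor_def bordered_mat_def ev_minor_mat
  by (rule det_rank_less[of t "Suc t" "\<lambda>a k. yvar k (if a < t then a else i)" "\<lambda>k b. yvar k (if b < t then b else j)"]) simp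

lemma ev_idl: "x \<in> idl (bordered_minors n t) \<Longrightarrow> ev t (x :: 'k::idom mpoly) = 0"
  by (induction x rule: idl.induct) (auto simp: subst_add subst_mult bordered_minors_def ev_bordered_minor)

text \<open>Eliminate the bottom variables: what remains is a top polynomial killed by
  \<open>ev\<close>, hence zero.\<close>

lemma kernel_idl:
  assumes "t < n" "a \<in> polys (sym_vars n)" "ev t (a :: 'k::idom mpoly) = 0"
  shows "\<exists>M. corner_minor t ^ M * a \<in> idl (bordered_minors n t)"
proof -
  obtain M c' where c: "c' \<in> polys (top_vars n t)" "corner_minor t ^ M * a - c' \<in> idl (bordered_minors n t)"
    using top_reducible_polys[OF assms(1,2)] by (auto simp: top_reducible_def)
  have "ev t c' = 0" using ev_idl[OF c(2)] assms(3) by (simp add: subst.hom_minus subst_mult)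
  then have "c' = 0" using top_independent c(1) by blast
  then show ?thesis using c(2) by auto
qed

section \<open>Frobenius traces\<close>

definition mscale :: "nat \<Rightarrow> ('v \<Rightarrow>\<^sub>0 nat) \<Rightarrow> ('v \<Rightarrow>\<^sub>0 nat)" where
  "mscale q m = Poly_Mapping.map ((*) q) m"

lemma lookup_mscale [simp]: "lookup (mscale q m) v = q * lookup m v"
  by (auto simp: mscale_def Poly_Mapping.map.rep_eq when_def)

lemma mscale_Suc: "mscale (Suc k) m = m + mscale k m"
  by (rule poly_mapping_eqI) (simp add: lookup_add)

lemma mscale_0 [simp]: "mscale 0 m = 0" "mscale q 0 = 0"
  by (rule poly_mapping_eqI; simp)+

lemma power_single: "Poly_Mapping.single m c ^ k = Poly_Mapping.single (mscale k m) (c ^ k :: 'k::comm_semiring_1)"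
  by (induction k) (auto simp: mult_single mscale_Suc)

lemma leads_power: "leads g p m \<Longrightarrow> leads g (p ^ k) (mscale k m)"
  by (induction k) (auto simp: leads_1 mscale_Suc intro: leads_mult)

lemma wsum_mscale: "wsum g (mscale k m) = k * wsum g m"
  by (induction k) (auto simp: mscale_Suc wsum_add)

text \<open>Let the field act on itself through q-th powers. This is a vector space in which
  \<open>1\<close> is independent, so \<open>1 \<mapsto> 1\<close> extends to a linear
  functional.\<close>

lemma frobenius_retraction:
  assumes "prime CHAR('k::field)" "q = CHAR('k) ^ e"
  shows "\<exists>\<pi>::'k \<Rightarrow> 'k. (\<forall>a b. \<pi> (a + b) = \<pi> a + \<pi> b) \<and> (\<forall>a b. \<pi> (a ^ q * b) = a * \<pi> b) \<and> \<pi> 1 = 1"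
proof -
  have q: "q > 0" using assms by (simp add: prime_gt_0_nat)
  interpret F: vector_space "\<lambda>(a::'k) (b::'k). a ^ q * b"
    by unfold_locales
      (auto simp: distrib_left distrib_right freshmans_dream'[OF assms] power_mult_distrib)
  interpret K: vector_space "\<lambda>(a::'k) (b::'k). a * b"
    by unfold_locales (auto simp: distrib_left distrib_right)
  interpret P: vector_space_pair "\<lambda>(a::'k) (b::'k). a ^ q * b" "\<lambda>(a::'k) (b::'k). a * b" ..
  have "\<not> F.dependent {1}" by simp
  then obtain g where g: "Vector_Spaces.linear (\<lambda>(a::'k) (b::'k). a ^ q * b) (\<lambda>(a::'k) (b::'k). a * b) g"
    "\<forall>x\<in>{1}. g x = 1" using P.linear_independent_extend[of "{1}" "\<lambda>_. 1"] by blast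
  interpret g: Vector_Spaces.linear "\<lambda>(a::'k) (b::'k). a ^ q * b" "\<lambda>(a::'k) (b::'k). a * b" g by (rule g(1))
  show ?thesis using g(2) by (intro exI[of _ g]) (auto simp: g.add g.scale)
qed

text \<open>The Cartier-type map sending \<open>x\<^bsup>s + q m\<^esup>\<close> to \<open>x\<^bsup>m\<^esup>\<close> and all other monomials to 0.\<close>

definition cartier :: "('k \<Rightarrow> 'k) \<Rightarrow> nat \<Rightarrow> ('v \<Rightarrow>\<^sub>0 nat) \<Rightarrow> (('v \<Rightarrow>\<^sub>0 nat) \<Rightarrow>\<^sub>0 'k::field) \<Rightarrow> (('v \<Rightarrow>\<^sub>0 nat) \<Rightarrow>\<^sub>0 'k)" where
  "cartier \<pi> q s p = Abs_poly_mapping (\<lambda>m. \<pi> (lookup p (mscale q m + s)))"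

lemma lookup_single_mult_zero:
  fixes k m :: "'v \<Rightarrow>\<^sub>0 nat" and b :: "('v \<Rightarrow>\<^sub>0 nat) \<Rightarrow>\<^sub>0 'b::comm_semiring_1"
  assumes "lookup k v < lookup m v"
  shows "lookup (Poly_Mapping.single m c * b) k = 0"
proof (rule ccontr)
  assume "\<not> ?thesis"
  then have "k \<in> keys (Poly_Mapping.single m c * b)" by (simp add: in_keys_iff)
  then obtain l where "k = m + l" using keys_mult[of "Poly_Mapping.single m c" b] by (fastforce split: if_splits)
  then show False using assms by (simp add: lookup_add)
qed

text \<open>Exponents of \<open>s\<close> below \<open>q\<close> make \<open>s\<close> a reduced
  residue modulo \<open>q\<close>; this is what lets q-th powers pass through the trace.\<close>

locale frobenius_trace =
  fixes \<pi> :: "'k::field \<Rightarrow> 'k" and q e :: nat and s :: "'v \<Rightarrow>\<^sub>0 nat"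
  assumes prime: "prime CHAR('k)" and q_def: "q = CHAR('k) ^ e"
    and pi_add: "\<pi> (a + b) = \<pi> a + \<pi> b" and pi_mult: "\<pi> (a ^ q * b) = a * \<pi> b" and pi_1: "\<pi> 1 = 1"
    and s_less: "lookup s v < q"
begin

abbreviation "\<Phi> \<equiv> cartier \<pi> q s"

lemma q_pos: "q > 0" using prime q_def by (simp add: prime_gt_0_nat)

lemma pi_0: "\<pi> 0 = 0"
  using pi_mult[of 0 0] by simp

lemma lookup_trace: "lookup (\<Phi> p) m = \<pi> (lookup p (mscale q m + s))"
proof -
  have inj: "inj (\<lambda>m. mscale q m + s)"
  proof (rule injI)
    fix m m' assume "mscale q m + s = mscale q m' + s"
    then have "mscale q m = mscale q m'" by simp
    then have "lookup (mscale q m) v = lookup (mscale q m') v" for v by simp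
    then show "m = m'" using q_pos by (auto intro: poly_mapping_eqI)
  qed
  have "{m. \<pi> (lookup p (mscale q m + s)) \<noteq> 0} \<subseteq> (\<lambda>m. mscale q m + s) -` keys p"
    by (auto simp: in_keys_iff pi_0)
  then have "finite {m. \<pi> (lookup p (mscale q m + s)) \<noteq> 0}"
    using finite_vimageI[OF finite_keys inj] by (rule finite_subset)
  then show ?thesis by (simp add: cartier_def)
qed

lemma trace_add: "\<Phi> (x + y) = \<Phi> x + \<Phi> y"
  by (rule poly_mapping_eqI) (simp add: lookup_trace lookup_add pi_add)

lemma trace_0: "\<Phi> 0 = 0"
  by (rule poly_mapping_eqI) (simp add: lookup_trace pi_0)

lemma power_q_add: "(x + y :: ('v \<Rightarrow>\<^sub>0 nat) \<Rightarrow>\<^sub>0 'k) ^ q = x ^ q + y ^ q"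
  by (rule freshmans_dream'[where n = e]) (auto simp: CHAR_poly_mapping prime q_def)

lemma trace_power_mult: "\<Phi> (a ^ q * b) = a * \<Phi> b"
proof (induction a rule: poly_mapping_add_induct)
  case (single m c)
  show ?case
  proof (rule poly_mapping_eqI)
    fix k
    show "lookup (\<Phi> (Poly_Mapping.single m c ^ q * b)) k = lookup (Poly_Mapping.single m c * \<Phi> b) k"
    proof (cases "\<exists>v. lookup k v < lookup m v")
      case True
      then obtain v where v: "lookup k v < lookup m v" by blast
      \<comment> \<open>If \<open>m\<close> does not divide \<open>k\<close>, then, as
        \<open>s\<close> stays below \<open>q\<close>, \<open>mscale q m\<close> does not divide
        \<open>mscale q k + s\<close> either. Both coefficients vanish.\<close>
      then have "q * lookup k v + q \<le> q * lookup m v"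
        by (metis Suc_leI mult_Suc_right add.commute mult_le_mono2)
      then have "lookup (mscale q k + s) v < lookup (mscale q m) v"
        using s_less[of v] by (simp add: lookup_add)
      then show ?thesis using v
        by (simp add: lookup_trace power_single lookup_single_mult_zero[where v = v] pi_0)
    next
      case False
      then have "k = m + (k - m)"
        by (intro poly_mapping_eqI) (auto simp: lookup_add lookup_minus not_less)
      then obtain l where k: "k = m + l" by blast
      have ms: "mscale q (m + l) + s = mscale q m + (mscale q l + s)"
        by (rule poly_mapping_eqI) (simp add: lookup_add distrib_left)
      show ?thesis
        unfolding k lookup_trace ms power_single lookup_single_mult_add pi_mult ..
    qed
  qed
qed (simp add: power_q_add distrib_right trace_add)

lemma trace_polys: assumes "p \<in> polys V" shows "\<Phi> p \<in> polys V"
  unfolding polys_def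
proof safe
  fix m v assume "m \<in> keys (\<Phi> p)" "v \<in> keys m"
  then have "mscale q m + s \<in> keys p" by (auto simp: in_keys_iff lookup_trace pi_0)
  moreover have "v \<in> keys (mscale q m + s)" using \<open>v \<in> keys m\<close> q_pos by (simp add: in_keys_iff lookup_add)
  ultimately show "v \<in> V" using assms by (auto simp: polys_def)
qed

lemma trace_idl: "x \<in> idl ((\<lambda>x. x ^ q) ` G) \<Longrightarrow> \<Phi> x \<in> idl G"
proof (induction x rule: idl.induct)
  case (idl_step x b r)
  then obtain g where "g \<in> G" "b = g ^ q" by blast
  have "\<Phi> (r * b + x) = \<Phi> (g ^ q * r) + \<Phi> x"
    unfolding trace_add \<open>b = g ^ q\<close> by (simp only: mult.commute)
  also have "\<dots> = \<Phi> r * g + \<Phi> x" unfolding trace_power_mult by (simp only: mult.commute)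
  also have "\<dots> \<in> idl G" using idl_step.IH \<open>g \<in> G\<close> by (rule idl.idl_step)
  finally show ?case .
qed (simp add: trace_0)

text \<open>For \<open>m \<noteq> 0\<close> positivity of the weight makes
  \<open>mscale q m + s\<close> heavier than \<open>s\<close>, so it does not occur in
  \<open>p\<close>; only the leading coefficient is read off.\<close>

lemma trace_leads:
  assumes "leads g p s" "\<And>v. g v > 0"
  shows "\<Phi> p = 1"
proof (rule poly_mapping_eqI)
  fix m
  show "lookup (\<Phi> p) m = lookup 1 m"
  proof (cases "m = 0")
    case True
    then show ?thesis using assms(1) by (simp add: lookup_trace leads_def pi_1)
  next
    case False
    then obtain v where "v \<in> keys m" by (metis all_not_in_conv keys_eq_empty)
    then have "0 < lookup m v * g v" using assms(2)[of v] by (simp add: in_keys_iff)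
    also have "\<dots> \<le> wsum g m" unfolding wsum_def using \<open>v \<in> keys m\<close> by (intro member_le_sum) auto
    finally have w: "0 < wsum g m" .
    then have "wsum g s < wsum g (mscale q m + s)" using q_pos by (simp add: wsum_add wsum_mscale)
    then have "mscale q m + s \<notin> keys p" using assms(1) unfolding leads_def by fastforce
    then show ?thesis using False by (simp add: lookup_trace in_keys_iff pi_0 lookup_one when_def)
  qed
qed

end

text \<open>After multiplication by a power of \<open>corner_minor t\<close>, the product \<open>g * a\<close> lies in the Frobenius power of the
  kernel, because it is a form of degree \<open>card (bottom_vars n t) * (q - 1) + 1\<close> in \<open>card (bottom_vars n t)\<close> generators.\<close>

lemma trace_kernel:
  fixes g a :: "'k::field mpoly"
  assumes ft: "frobenius_trace \<pi> q e s" and t: "t < n"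
    and g: "corner_minor t ^ N * g \<in> ipow (bordered_minors n t) (card (bottom_vars n t) * (q - 1))"
    and a: "a \<in> polys (sym_vars n)" "ev t a = 0"
  shows "ev t (cartier \<pi> q s (g * a)) = 0"
proof -
  interpret frobenius_trace \<pi> q e s by (rule ft)
  obtain M where M: "corner_minor t ^ M * a \<in> idl (bordered_minors n t)" using kernel_idl[OF t a] by blast
  let ?K = "N + M"
  have "(corner_minor t ^ N * g) * (corner_minor t ^ M * a) \<in> ipow (bordered_minors n t) (card (bottom_vars n t) * (q - 1) + Suc 0)"
    using g M by (intro ipow_mult) (auto simp: ipow_one)
  \<comment> \<open>The extra factor completes the exponent \<open>?K\<close> to
    \<open>?K * q\<close>, a q-th power that the trace releases as
    \<open>corner_minor t ^ ?K\<close>.\<close>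
  then have "corner_minor t ^ (?K * (q - 1)) * ((corner_minor t ^ N * g) * (corner_minor t ^ M * a))
      \<in> ipow (bordered_minors n t) (card (bottom_vars n t) * (q - 1) + Suc 0)"
    by (rule ipow_mult_left)
  also have "corner_minor t ^ (?K * (q - 1)) * ((corner_minor t ^ N * g) * (corner_minor t ^ M * a)) = corner_minor t ^ (?K * (q - 1) + ?K) * (g * a)"
    by (simp add: power_add mult_ac)
  also have "?K * (q - 1) + ?K = ?K * q"
    using q_pos by (cases q) auto
  finally have 1: "(corner_minor t ^ ?K) ^ q * (g * a) \<in> ipow (bordered_minors n t) (card (bottom_vars n t) * (q - 1) + Suc 0)"
    by (simp add: power_mult)
  have "card (bordered_minors n t :: 'k mpoly set) \<le> card (bottom_vars n t)"
    unfolding bordered_minors_def by (rule card_image_le) simp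
  then have "ipow (bordered_minors n t) (card (bottom_vars n t) * (q - 1) + Suc 0) \<subseteq> idl ((\<lambda>x. x ^ q) ` (bordered_minors n t :: 'k mpoly set))"
    by (intro ipow_pigeonhole) (auto simp: bordered_minors_def less_Suc_eq_le)
  then have "cartier \<pi> q s ((corner_minor t ^ ?K) ^ q * (g * a)) \<in> idl (bordered_minors n t)"
    using 1 by (intro trace_idl) auto
  then have "ev t (corner_minor t ^ ?K * cartier \<pi> q s (g * a)) = 0"
    unfolding trace_power_mult by (rule ev_idl)
  \<comment> \<open>The target of \<open>ev\<close> is a domain, so the nonzero image of the power
    cancels.\<close>
  then show ?thesis using ev_corner_minor[OF t, where 'k='k] by (simp add: subst_mult subst.hom_power)
qed

section \<open>Splittings\<close>

definition vsum :: "'v set \<Rightarrow> ('v \<Rightarrow>\<^sub>0 nat)" where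
  "vsum A = (\<Sum>v\<in>A. Poly_Mapping.single v 1)"

lemma lookup_vsum: "finite A \<Longrightarrow> lookup (vsum A) v = of_bool (v \<in> A)"
  by (simp add: vsum_def lookup_sum lookup_single when_def)

lemma sym_vars_bottom_vars: "sym_vars n = bottom_vars n 0"
  by (auto simp: sym_vars_def bottom_vars_def)

lemma finite_sym_vars [simp]: "finite (sym_vars n)"
  by (simp add: sym_vars_bottom_vars)

text \<open>The exponent \<open>q - 1\<close> at every variable: the residue of the standard
  Frobenius trace of the polynomial ring.\<close>

definition shift :: "nat \<Rightarrow> nat \<Rightarrow> mono" where
  "shift n q = mscale (q - 1) (vsum (sym_vars n))"

lemma lookup_shift: "lookup (shift n q) v = (if v \<in> sym_vars n then q - 1 else 0)"
  by (simp add: shift_def lookup_vsum)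

lemma frobenius_trace_exists:
  assumes "prime CHAR('k::field)" "q = CHAR('k) ^ e"
  shows "\<exists>\<pi>::'k \<Rightarrow> 'k. frobenius_trace \<pi> q e (shift n q)"
proof -
  obtain \<pi> :: "'k \<Rightarrow> 'k" where "\<forall>a b. \<pi> (a + b) = \<pi> a + \<pi> b" "\<forall>a b. \<pi> (a ^ q * b) = a * \<pi> b" "\<pi> 1 = 1"
    using frobenius_retraction[OF assms] by blast
  moreover have "q > 0" using assms by (simp add: prime_gt_0_nat)
  ultimately have "frobenius_trace \<pi> q e (shift n q)"
    using assms by unfold_locales (auto simp: lookup_shift)
  then show ?thesis by blast
qed

section \<open>Traces sending a power of the corner minor to 1\<close>

definition diag_minor :: "nat \<Rightarrow> nat \<Rightarrow> 'k::comm_ring_1 mpoly" where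
  "diag_minor n d = det (mat (n - d) (n - d) (\<lambda>(i, j). xvar i (j + d)))"

lemma diag_minor_polys: "diag_minor n d \<in> polys (sym_vars n)"
  unfolding diag_minor_def by (rule polys_det) (auto intro!: xvar_polys)

text \<open>The main diagonal of \<open>diag_minor n d\<close> is the d-th parallel, and the
  parallels cover each variable exactly once.\<close>

lemma leads_diag_minor_prod: "leads wt (\<Prod>d<n. diag_minor n d :: 'k::comm_ring_1 mpoly) (vsum (sym_vars n))"
proof -
  have "leads wt (\<Prod>d<n. diag_minor n d :: 'k mpoly) (\<Sum>d<n. \<Sum>i<n - d. xmono i (i + d))"
    unfolding diag_minor_def
    by (intro leads_prod leads_minor[where a = "\<lambda>i. i" and b = "\<lambda>j. j + _"]) auto
  also have "(\<Sum>d<n. \<Sum>i<n - d. xmono i (i + d))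
      = (\<Sum>(d, i)\<in>(SIGMA d:{..<n - 0}. {..<n - d - 0}). Poly_Mapping.single (0 + i, 0 + i + d) 1)"
    by (subst sum.Sigma) (auto simp: xmono_def)
  also have "\<dots> = vsum (bottom_vars n 0)"
    unfolding vsum_def
    by (subst sum.reindex_bij_betw[OF bottom_vars_bij[of 0 n], symmetric]) (auto intro: sum.cong)
  finally show ?thesis by (simp add: sym_vars_bottom_vars)
qed

lemma trace_diag_minor_prod:
  assumes "frobenius_trace \<pi> q e (shift n q)"
  shows "cartier \<pi> q (shift n q) ((\<Prod>d<n. diag_minor n d) ^ (q - 1)) = 1"
proof -
  interpret frobenius_trace \<pi> q e "shift n q" by fact
  show ?thesis
    by (rule trace_leads[where g = wt]) (auto simp: shift_def wt_def intro!: leads_power leads_diag_minor_prod)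
qed

text \<open>A minor of size \<open>n - d\<close> contributes \<open>n - d - t\<close> to the power
  of the ideal; over all \<open>d < n - t\<close> these add up to
  \<open>card (bottom_vars n t)\<close>.\<close>

lemma diag_minor_prod_ipow:
  "corner_minor t ^ (\<Sum>d<n - t. n - d) * (\<Prod>d<n - t. diag_minor n d) \<in> (ipow (bordered_minors n t) (card (bottom_vars n t)) :: 'k::idom mpoly set)"
proof -
  have "(\<Prod>d<n - t. corner_minor t ^ (n - d) * diag_minor n d) \<in> (ipow (bordered_minors n t) (card (bottom_vars n t)) :: 'k mpoly set)"
    unfolding card_bottom_vars
  proof (rule ipow_prod)
    show "corner_minor t ^ (n - d) * diag_minor n d \<in> (ipow (bordered_minors n t) (n - d - t) :: 'k mpoly set)" for d
      unfolding diag_minor_def by (rule minor_ipow[where a = "\<lambda>i. i" and b = "\<lambda>j. j + d"]) auto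
  qed simp
  then show ?thesis by (simp add: prod.distrib power_sum)
qed

definition opposite_corner_minor :: "nat \<Rightarrow> nat \<Rightarrow> 'k::comm_ring_1 mpoly" where
  "opposite_corner_minor n t = det (mat t t (\<lambda>(i, j). xvar (i + (n - t)) (j + (n - t))))"

text \<open>For size exactly \<open>t\<close> the Gram factorization is into square matrices, so the
  determinant splits.\<close>

lemma ev_minor_split:
  "ev t (det (mat t t (\<lambda>(i, j). xvar (a i) (b j))))
    = det (mat t t (\<lambda>(k, i). yvar k (a i))) * (det (mat t t (\<lambda>(k, j). yvar k (b j))) :: 'k::comm_ring_1 mpoly)"
proof -
  let ?A = "mat t t (\<lambda>(k, i). yvar k (a i)) :: 'k mpoly mat" and ?B = "mat t t (\<lambda>(k, j). yvar k (b j)) :: 'k mpoly mat"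
  have "mat t t (\<lambda>(i, j). \<Sum>k<t. yvar k (a i) * yvar k (b j)) = transpose_mat ?A * ?B"
    by (rule eq_matI) (auto simp: scalar_prod_def atLeast0LessThan)
  moreover have "det (transpose_mat ?A * ?B) = det ?A * det ?B"
    by (subst det_mult[of _ t]) (auto simp: det_transpose[of _ t])
  ultimately show ?thesis unfolding ev_minor_mat by metis
qed

text \<open>With A and B the minors of \<open>Y\<close> on the first and last \<open>t\<close>
  columns, the three images are A B, A A and B B.\<close>

lemma ev_diag_minor_sq:
  assumes "t \<le> n"
  shows "ev t (diag_minor n (n - t) ^ 2) = ev t (corner_minor t * opposite_corner_minor n t :: 'k::comm_ring_1 mpoly)"
proof -
  have "diag_minor n (n - t) = (det (mat t t (\<lambda>(i, j). xvar i (j + (n - t)))) :: 'k mpoly)"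
    using assms by (simp add: diag_minor_def)
  then show ?thesis
    unfolding corner_minor_def opposite_corner_minor_def power2_eq_square subst_mult by (simp add: ev_minor_split mult_ac del: subst.hom_det)
qed

lemma opposite_corner_minor_polys: "t \<le> n \<Longrightarrow> opposite_corner_minor n t \<in> polys (sym_vars n)"
  unfolding opposite_corner_minor_def by (rule polys_det) (auto intro!: xvar_polys)

lemma corner_minor_polys: "t \<le> n \<Longrightarrow> corner_minor t \<in> polys (sym_vars n)"
  using corner_minor_top polys_mono[OF top_vars_sym_vars] by blast

text \<open>Start from the \<open>(q - 1)\<close>-st power of the diagonal product, whose trace is
  1, and replace 2h of its factors \<open>diag_minor n (n - t)\<close> by \<mu>^h times the h-th
  power of the opposite corner minor. The minors larger than \<open>t\<close> remain in
  \<open>g\<close> and keep the trace compatible with the kernel.\<close>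

lemma split_corner_minor:
  assumes t: "0 < t" "t < n" and ft: "frobenius_trace \<pi> q e (shift n q)" and q: "2 * h \<le> q - 1"
  shows "\<exists>N g. corner_minor t ^ N * g \<in> ipow (bordered_minors n t) (card (bottom_vars n t) * (q - 1)) \<and> g \<in> polys (sym_vars n)
    \<and> ev t (cartier \<pi> q (shift n q) (g * corner_minor t ^ h)) = (1 :: 'k::field mpoly)"
proof -
  interpret frobenius_trace \<pi> q e "shift n q" by (rule ft)
  let ?f' = "\<Prod>d<n - t. diag_minor n d :: 'k mpoly"
  let ?N = "\<Sum>d<n - t. n - d"
  let ?c = "diag_minor n (n - t) :: 'k mpoly"
  let ?D = "\<Prod>d\<in>{Suc (n - t)..<n}. diag_minor n d :: 'k mpoly"
  define r where "r = ?c ^ (q - 1 - 2 * h) * ?D ^ (q - 1)"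
  define g where "g = ?f' ^ (q - 1) * (r * opposite_corner_minor n t ^ h)"
  have "(corner_minor t ^ ?N * ?f') ^ (q - 1) \<in> ipow (bordered_minors n t) (card (bottom_vars n t) * (q - 1))"
    by (rule ipow_power) (rule diag_minor_prod_ipow)
  then have f': "corner_minor t ^ (?N * (q - 1)) * ?f' ^ (q - 1) \<in> ipow (bordered_minors n t) (card (bottom_vars n t) * (q - 1))"
    by (simp add: power_mult_distrib power_mult)
  have "(r * opposite_corner_minor n t ^ h) * (corner_minor t ^ (?N * (q - 1)) * ?f' ^ (q - 1)) \<in> ipow (bordered_minors n t) (card (bottom_vars n t) * (q - 1))"
    using f' by (rule ipow_mult_left)
  then have g1: "corner_minor t ^ (?N * (q - 1)) * g \<in> ipow (bordered_minors n t) (card (bottom_vars n t) * (q - 1))"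
    by (simp add: g_def mult_ac)
  have r: "r \<in> polys (sym_vars n)" unfolding r_def by (intro polys_mult polys_power polys_prod diag_minor_polys)
  have g2: "g \<in> polys (sym_vars n)"
    unfolding g_def using r t by (intro polys_mult polys_power polys_prod diag_minor_polys opposite_corner_minor_polys) auto
  \<comment> \<open>The error of the replacement, which lies in the kernel.\<close>
  define a where "a = r * ((?c ^ 2) ^ h - (corner_minor t * opposite_corner_minor n t) ^ h)"
  have a: "a \<in> polys (sym_vars n)" unfolding a_def using r t
    by (intro polys_mult polys_diff polys_power diag_minor_polys corner_minor_polys opposite_corner_minor_polys) auto
  have "ev t a = 0"
    using ev_diag_minor_sq[of t n, where 'k='k] t by (simp add: a_def subst_mult subst.hom_minus subst.hom_power)
  then have "ev t (\<Phi> (?f' ^ (q - 1) * a)) = 0" using t f' a by (intro trace_kernel[OF ft]) auto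
  moreover have "(\<Prod>d<n. diag_minor n d :: 'k mpoly) ^ (q - 1) = ?f' ^ (q - 1) * a + g * corner_minor t ^ h"
  proof -
    have s: "{..<n} = {..<n - t} \<union> {n - t..<n}" "{n - t..<n} = insert (n - t) {Suc (n - t)..<n}"
      using t by auto
    have "(\<Prod>d<n. diag_minor n d :: 'k mpoly) = ?f' * (\<Prod>d\<in>{n - t..<n}. diag_minor n d)"
      unfolding s(1) by (rule prod.union_disjoint) auto
    also have "(\<Prod>d\<in>{n - t..<n}. diag_minor n d :: 'k mpoly) = ?c * ?D"
      unfolding s(2) by (rule prod.insert) auto
    finally have "(\<Prod>d<n. diag_minor n d :: 'k mpoly) = ?f' * ?c * ?D" by (simp only: mult.assoc)
    moreover have "?c ^ (q - 1) = (?c ^ 2) ^ h * ?c ^ (q - 1 - 2 * h)"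
    proof -
      have "q - 1 = 2 * h + (q - 1 - 2 * h)" using q by simp
      then have "?c ^ (q - 1) = ?c ^ (2 * h + (q - 1 - 2 * h))" by (rule arg_cong)
      then show ?thesis by (simp only: power_add power_mult)
    qed
    ultimately have "(\<Prod>d<n. diag_minor n d :: 'k mpoly) ^ (q - 1) = ?f' ^ (q - 1) * ((?c ^ 2) ^ h * r)"
      by (simp add: power_mult_distrib r_def mult_ac)
    then show ?thesis by (simp add: a_def g_def power_mult_distrib algebra_simps)
  qed
  then have "ev t (\<Phi> (?f' ^ (q - 1) * a)) + ev t (\<Phi> (g * corner_minor t ^ h)) = 1"
    using trace_diag_minor_prod[OF ft] by (simp add: trace_add flip: subst_add)
  ultimately show ?thesis using g1 g2 by auto
qed

section \<open>Traces sending a given element to a power of the corner minor\<close>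

definition bottom_degree :: "nat \<Rightarrow> nat \<Rightarrow> mono \<Rightarrow> nat" where
  "bottom_degree n t m = wsum (\<lambda>v. of_bool (v \<in> bottom_vars n t)) m"

text \<open>Leading term by degree in the bottom variables alone, so the leading coefficient
  \<open>c\<close> is a polynomial in the top variables.\<close>

definition bottom_leads :: "nat \<Rightarrow> nat \<Rightarrow> 'k::comm_ring_1 mpoly \<Rightarrow> 'k mpoly \<Rightarrow> mono \<Rightarrow> bool" where
  "bottom_leads n t p c m \<longleftrightarrow> c \<in> polys (top_vars n t) \<and>
     (\<forall>k\<in>keys (p - c * Poly_Mapping.single m 1). bottom_degree n t k < bottom_degree n t m)"

lemma top_bottom_vars_disjoint: "top_vars n t \<inter> bottom_vars n t = {}"
  by (auto simp: top_vars_def bottom_vars_def)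

lemma bottom_degree_add: "bottom_degree n t (m + m') = bottom_degree n t m + bottom_degree n t m'"
  by (simp add: bottom_degree_def wsum_add)

lemma bottom_degree_top: "keys m \<subseteq> top_vars n t \<Longrightarrow> bottom_degree n t m = 0"
  using top_bottom_vars_disjoint[of n t] by (auto simp: bottom_degree_def wsum_def)

lemma bottom_leads_1: "bottom_leads n t 1 1 0"
  by (simp add: bottom_leads_def)

lemma bottom_leads_mult:
  fixes p p' c c' :: "'a::comm_ring_1 mpoly"
  assumes p: "bottom_leads n t p c m" and q: "bottom_leads n t p' c' m'"
  shows "bottom_leads n t (p * p') (c * c') (m + m')"
proof -
  let ?x = "c * Poly_Mapping.single m 1" and ?x' = "c' * Poly_Mapping.single m' 1"
  have kx: "bottom_degree n t k = bottom_degree n t l" if c: "c \<in> polys (top_vars n t)" "k \<in> keys (c * Poly_Mapping.single l (1::'a))"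
    for c :: "'a mpoly" and k l
  proof -
    obtain a where "k = a + l" "a \<in> keys c" using c(2) keys_mult[of c "Poly_Mapping.single l 1"] by auto
    then show ?thesis using c(1) bottom_degree_top[of a n t] by (auto simp: polys_def bottom_degree_add)
  qed
  have e: "p * p' - c * c' * Poly_Mapping.single (m + m') 1 = (p - ?x) * (p' - ?x') + (p - ?x) * ?x' + ?x * (p' - ?x')"
  proof -
    have "Poly_Mapping.single (m + m') (1::'a) = Poly_Mapping.single m 1 * Poly_Mapping.single m' 1"
      by (simp add: mult_single)
    then show ?thesis by (simp add: algebra_simps)
  qed
  have "bottom_degree n t k < bottom_degree n t m + bottom_degree n t m'" if "k \<in> keys (p * p' - c * c' * Poly_Mapping.single (m + m') 1)" for k
  proof -
    have U: "k \<in> keys ((p - ?x) * (p' - ?x')) \<union> keys ((p - ?x) * ?x') \<union> keys (?x * (p' - ?x'))"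
      using that unfolding e by (meson keys_add subsetD Un_iff)
    have low: "bottom_degree n t k < bottom_degree n t m + bottom_degree n t m'"
      if uv: "k \<in> keys (u * v)" "\<And>a. a \<in> keys u \<Longrightarrow> bottom_degree n t a \<le> bottom_degree n t m" "\<And>b. b \<in> keys v \<Longrightarrow> bottom_degree n t b \<le> bottom_degree n t m'"
        "(\<forall>a\<in>keys u. bottom_degree n t a < bottom_degree n t m) \<or> (\<forall>b\<in>keys v. bottom_degree n t b < bottom_degree n t m')" for u v :: "'a mpoly"
    proof -
      obtain a b where ab: "k = a + b" "a \<in> keys u" "b \<in> keys v" using uv(1) keys_mult[of u v] by blast
      have "bottom_degree n t a < bottom_degree n t m \<or> bottom_degree n t b < bottom_degree n t m'" using ab uv(4) by blast
      then show ?thesis using uv(2)[OF ab(2)] uv(3)[OF ab(3)] unfolding ab(1) bottom_degree_add by linarith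
    qed
    have P: "bottom_degree n t a < bottom_degree n t m" if "a \<in> keys (p - ?x)" for a
      using p that unfolding bottom_leads_def by blast
    have P': "bottom_degree n t a < bottom_degree n t m'" if "a \<in> keys (p' - ?x')" for a
      using q that unfolding bottom_leads_def by blast
    have X: "bottom_degree n t a = bottom_degree n t m" if "a \<in> keys ?x" for a
      using kx[OF _ that] p unfolding bottom_leads_def by blast
    have X': "bottom_degree n t a = bottom_degree n t m'" if "a \<in> keys ?x'" for a
      using kx[OF _ that] q unfolding bottom_leads_def by blast
    from U show ?thesis
    proof (elim UnE)
      assume "k \<in> keys ((p - ?x) * (p' - ?x'))"
      then show ?thesis by (rule low) (simp_all add: P P' less_imp_le)
    next
      assume "k \<in> keys ((p - ?x) * ?x')"
      then show ?thesis by (rule low) (simp_all add: P X' less_imp_le)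
    next
      assume "k \<in> keys (?x * (p' - ?x'))"
      then show ?thesis by (rule low) (simp_all add: X P' less_imp_le)
    qed
  qed
  then show ?thesis using p q unfolding bottom_leads_def by (auto simp: polys_mult bottom_degree_add)
qed

lemma bottom_leads_prod:
  "finite A \<Longrightarrow> (\<And>i. i \<in> A \<Longrightarrow> bottom_leads n t (f i) (c i) (m i)) \<Longrightarrow> bottom_leads n t (prod f A) (prod c A) (sum m A)"
  by (induction A rule: finite_induct) (auto simp: bottom_leads_1 bottom_leads_mult)

lemma bottom_leads_power: "bottom_leads n t p c m \<Longrightarrow> bottom_leads n t (p ^ k) (c ^ k) (mscale k m)"
  by (induction k) (auto simp: bottom_leads_1 mscale_Suc intro: bottom_leads_mult)

lemma bottom_leads_bordered_minor:
  assumes "t < n" "(i, j) \<in> bottom_vars n t"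
  shows "bottom_leads n t (bordered_minor t i j :: 'k::comm_ring_1 mpoly) (corner_minor t) (Poly_Mapping.single (i, j) 1)"
proof -
  have ij: "t \<le> i" "i \<le> j" "j < n" using assms(2) by (auto simp: bottom_vars_def)
  have x: "xvar i j = Poly_Mapping.single (Poly_Mapping.single (i, j) 1) (1::'k)"
    using ij by (simp add: xvar_def)
  have "bordered_minor t i j - corner_minor t * xvar i j \<in> (polys (top_vars n t) :: 'k mpoly set)"
    unfolding bordered_minor_expand using assms ij by (auto intro!: polys_sum polys_mult xvar_top bordered_cofactor_top)
  then have "\<forall>k\<in>keys (bordered_minor t i j - corner_minor t * xvar i j :: 'k mpoly). bottom_degree n t k = 0"
    by (auto simp: polys_def intro: bottom_degree_top)
  then show ?thesis
    using assms corner_minor_top[of t n, where 'a='k] unfolding bottom_leads_def x by (auto simp: bottom_degree_def)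
qed

lemma bordered_minor_prod_ipow:
  "(\<Prod>(i, j)\<in>bottom_vars n t. bordered_minor t i j) \<in> (ipow (bordered_minors n t) (card (bottom_vars n t)) :: 'k::comm_ring_1 mpoly set)"
proof -
  have "(\<Prod>(i, j)\<in>bottom_vars n t. bordered_minor t i j) \<in> (ipow (bordered_minors n t) (\<Sum>v\<in>bottom_vars n t. 1) :: 'k mpoly set)"
    by (rule ipow_prod) (auto simp: ipow_one bordered_minors_def intro!: idl_base)
  then show ?thesis by simp
qed

lemma wsum_vsum: "finite A \<Longrightarrow> wsum (\<lambda>v. of_bool (v \<in> B)) (vsum A) = card (A \<inter> B)"
  by (simp add: vsum_def wsum_sum of_bool_def sum.If_cases)

lemma bottom_degree_shift: "bottom_degree n t (shift n q) = (q - 1) * card (bottom_vars n t)"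
proof -
  have "sym_vars n \<inter> bottom_vars n t = bottom_vars n t" by (auto simp: sym_vars_def bottom_vars_def)
  then show ?thesis by (simp add: bottom_degree_def shift_def wsum_mscale wsum_vsum)
qed

lemma top_vars_finite [simp]: "finite (top_vars n t)"
  using finite_subset[OF top_vars_sym_vars] by simp

lemma keys_vsum_minus: "finite A \<Longrightarrow> keys (mscale k (vsum A) - m) \<subseteq> A"
  by (rule subsetI, rule ccontr) (simp add: in_keys_iff lookup_minus lookup_vsum)

text \<open>The monomial \<open>g\<close> completes \<open>m\<close> to exponent
  \<open>q - 1\<close> at every top variable, while the leading part of the bordered minors supplies
  the bottom ones. The factor \<open>corner_minor t ^ card (bottom_vars n t)\<close> turns the
  leading coefficient into a q-th power.\<close>

lemma trace_bordered_minor_prod: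
  fixes c :: "'k::field mpoly"
  assumes t: "t < n" and ft: "frobenius_trace \<pi> q e (shift n q)"
    and c: "c \<in> polys (top_vars n t)" "m \<in> keys c" "\<And>k v. k \<in> keys c \<Longrightarrow> lookup k v < q"
  defines "g \<equiv> Poly_Mapping.single (mscale (q - 1) (vsum (top_vars n t)) - m) (inverse (lookup c m))"
  shows "cartier \<pi> q (shift n q) ((\<Prod>(i, j)\<in>bottom_vars n t. bordered_minor t i j) ^ (q - 1) * ((corner_minor t ^ card (bottom_vars n t) * g) * c))
    = corner_minor t ^ card (bottom_vars n t)"
proof -
  interpret frobenius_trace \<pi> q e "shift n q" by (rule ft)
  let ?h = "card (bottom_vars n t)"
  let ?F = "(\<Prod>(i, j)\<in>bottom_vars n t. bordered_minor t i j) :: 'k mpoly"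
  let ?B = "mscale (q - 1) (vsum (bottom_vars n t))"
  let ?T = "mscale (q - 1) (vsum (top_vars n t))"
  let ?L = "?F ^ (q - 1) - (corner_minor t ^ ?h) ^ (q - 1) * Poly_Mapping.single ?B 1"
  have "bottom_leads n t ?F (\<Prod>v\<in>bottom_vars n t. corner_minor t) (vsum (bottom_vars n t))"
    unfolding vsum_def
  proof (rule bottom_leads_prod)
    fix v assume "v \<in> bottom_vars n t"
    then show "bottom_leads n t ((\<lambda>(i, j). bordered_minor t i j) v :: 'k mpoly) (corner_minor t) (Poly_Mapping.single v 1)"
      using bottom_leads_bordered_minor[OF t, of "fst v" "snd v"] by (simp add: case_prod_beta)
  qed simp
  then have "bottom_leads n t (?F ^ (q - 1)) ((corner_minor t ^ ?h) ^ (q - 1)) ?B"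
    using bottom_leads_power by fastforce
  then have L: "bottom_degree n t k < (q - 1) * ?h" if "k \<in> keys ?L" for k
    using that unfolding bottom_leads_def by (auto simp: bottom_degree_def wsum_mscale wsum_vsum)
  \<comment> \<open>The trace reads only exponents \<open>mscale q k + shift n q\<close>, whose
    bottom degree is at least \<open>(q - 1) * ?h\<close>; terms of \<open>?L\<close> stay below it,
    also after multiplication by top polynomials.\<close>
  have zero: "\<Phi> (?L * w) = 0" if w: "w \<in> polys (top_vars n t)" for w
  proof (rule poly_mapping_eqI)
    fix k
    have "mscale q k + shift n q \<notin> keys (?L * w)"
    proof
      assume "mscale q k + shift n q \<in> keys (?L * w)"
      then obtain a b where ab: "mscale q k + shift n q = a + b" "a \<in> keys ?L" "b \<in> keys w"
        using keys_mult[of ?L w] by blast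
      have "bottom_degree n t b = 0" using ab(3) w by (intro bottom_degree_top) (auto simp: polys_def)
      then have "bottom_degree n t (mscale q k + shift n q) < (q - 1) * ?h"
        unfolding ab(1) bottom_degree_add using L[OF ab(2)] by simp
      then show False by (simp add: bottom_degree_add bottom_degree_shift)
    qed
    then show "lookup (\<Phi> (?L * w)) k = lookup 0 k" by (simp add: lookup_trace in_keys_iff pi_0)
  qed
  have gt: "g \<in> polys (top_vars n t)"
    unfolding g_def by (intro polys_single keys_vsum_minus) simp
  have mT: "lookup m v \<le> lookup ?T v" for v
  proof (cases "v \<in> keys m")
    case True
    then have "v \<in> top_vars n t" using c(1,2) by (auto simp: polys_def)
    then show ?thesis using c(3)[OF c(2), of v] by (simp add: lookup_vsum)
  qed (simp add: in_keys_iff)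
  have sh: "shift n q = (?B + (?T - m)) + m"
  proof (rule poly_mapping_eqI)
    fix v
    have "v \<in> sym_vars n \<longleftrightarrow> v \<in> bottom_vars n t \<or> v \<in> top_vars n t" "\<not> (v \<in> bottom_vars n t \<and> v \<in> top_vars n t)"
      by (auto simp: sym_vars_def bottom_vars_def top_vars_def)
    then show "lookup (shift n q) v = lookup (?B + (?T - m) + m) v"
      using mT[of v] by (auto simp: lookup_shift lookup_add lookup_minus lookup_vsum)
  qed
  have one: "\<Phi> (Poly_Mapping.single ?B 1 * (g * c)) = 1"
  proof (rule poly_mapping_eqI)
    fix k
    have e: "Poly_Mapping.single ?B 1 * (g * c) = Poly_Mapping.single (?B + (?T - m)) (inverse (lookup c m)) * c"
      unfolding g_def by (simp add: mult_single mult.assoc[symmetric])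
    have s: "mscale q k + shift n q = (?B + (?T - m)) + (mscale q k + m)"
      unfolding sh by (simp add: add_ac)
    have l: "lookup (\<Phi> (Poly_Mapping.single ?B 1 * (g * c))) k = \<pi> (inverse (lookup c m) * lookup c (mscale q k + m))"
      unfolding lookup_trace e s lookup_single_mult_add ..
    show "lookup (\<Phi> (Poly_Mapping.single ?B 1 * (g * c))) k = lookup 1 k"
    proof (cases "k = 0")
      case True
      then show ?thesis unfolding l using c(2) by (simp add: pi_1 in_keys_iff)
    next
      case False
      then obtain v where "v \<in> keys k" by (metis all_not_in_conv keys_eq_empty)
      \<comment> \<open>For \<open>k \<noteq> 0\<close> the coefficient sits at an exponent of at
        least \<open>q\<close>, whereas those of \<open>c\<close> are below
        \<open>q\<close>.\<close>
      then have "q \<le> lookup (mscale q k + m) v" by (auto simp: lookup_add in_keys_iff intro!: trans_le_add1)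
      then have "mscale q k + m \<notin> keys c" using c(3) by (meson leD)
      then show ?thesis unfolding l using False by (simp add: in_keys_iff pi_0 lookup_one when_def)
    qed
  qed
  have "corner_minor t ^ ?h * g * c \<in> polys (top_vars n t)" using c(1) gt t by (intro polys_mult polys_power corner_minor_top) auto
  note z = zero[OF this]
  have "?F ^ (q - 1) * ((corner_minor t ^ ?h * g) * c)
      = ?L * (corner_minor t ^ ?h * g * c) + (corner_minor t ^ ?h) ^ (q - 1) * corner_minor t ^ ?h * (Poly_Mapping.single ?B 1 * (g * c))"
    by (simp add: algebra_simps)
  also have "(corner_minor t ^ ?h) ^ (q - 1) * corner_minor t ^ ?h = ((corner_minor t ^ ?h) ^ q :: 'k mpoly)"
    using q_pos by (simp flip: power_Suc2)
  finally have "\<Phi> (?F ^ (q - 1) * ((corner_minor t ^ ?h * g) * c)) =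
      \<Phi> (?L * (corner_minor t ^ ?h * g * c)) + \<Phi> ((corner_minor t ^ ?h) ^ q * (Poly_Mapping.single ?B 1 * (g * c)))"
    by (simp only: trace_add)
  also have "\<dots> = corner_minor t ^ ?h"
    unfolding z trace_power_mult one by simp
  finally show ?thesis .
qed

text \<open>A power of \<mu> turns \<open>c\<close> into a nonzero top polynomial \<open>c'\<close>
  modulo the kernel, and \<open>c'\<close> is handled by the previous trace. The bound
  \<open>b\<close> depends only on \<open>c'\<close>, so it is fixed before
  \<open>q\<close>.\<close>

lemma split_off_kernel:
  fixes c :: "'k::field mpoly"
  assumes t: "t < n" and c: "c \<in> polys (sym_vars n)" "ev t c \<noteq> 0"
  shows "\<exists>b. \<forall>q e \<pi>. b < q \<longrightarrow> frobenius_trace \<pi> q e (shift n q) \<longrightarrow>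
    (\<exists>N g. corner_minor t ^ N * g \<in> ipow (bordered_minors n t) (card (bottom_vars n t) * (q - 1)) \<and> g \<in> polys (sym_vars n)
    \<and> ev t (cartier \<pi> q (shift n q) (g * c) - corner_minor t ^ card (bottom_vars n t)) = 0)"
proof -
  obtain M c' where c': "c' \<in> polys (top_vars n t)" "corner_minor t ^ M * c - c' \<in> idl (bordered_minors n t)"
    using top_reducible_polys[OF t c(1)] by (auto simp: top_reducible_def)
  let ?r = "corner_minor t ^ M * c - c'"
  have "ev t ?r = 0" using c'(2) by (rule ev_idl)
  have "c' \<noteq> 0"
  proof
    assume "c' = 0"
    then have "ev t (corner_minor t) ^ M * ev t c = 0" using \<open>ev t ?r = 0\<close> by (simp add: subst_mult subst.hom_power)
    then show False using c(2) ev_corner_minor[OF t, where 'k='k] by simp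
  qed
  then obtain m where m: "m \<in> keys c'" by (metis all_not_in_conv keys_eq_empty)
  have c's: "c' \<in> polys (sym_vars n)" using c'(1) polys_mono[OF top_vars_sym_vars] by blast
  \<comment> \<open>A crude bound on all exponents of \<open>c'\<close>: the sum of them
    all.\<close>
  define b where "b = (\<Sum>k\<in>keys c'. \<Sum>v\<in>keys k. lookup k v)"
  have b: "lookup k v \<le> b" if "k \<in> keys c'" for k v
  proof (cases "v \<in> keys k")
    case True
    then have "lookup k v \<le> (\<Sum>v\<in>keys k. lookup k v)" by (intro member_le_sum) auto
    also have "\<dots> \<le> b" unfolding b_def using that
      by (intro member_le_sum[where f = "\<lambda>k. \<Sum>v\<in>keys k. lookup k v"]) auto
    finally show ?thesis .
  qed (simp add: in_keys_iff)
  show ?thesis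
  proof (rule exI[of _ b], intro allI impI)
    fix q e :: nat and \<pi> :: "'k \<Rightarrow> 'k"
    assume q: "b < q" and ft: "frobenius_trace \<pi> q e (shift n q)"
    interpret frobenius_trace \<pi> q e "shift n q" by (rule ft)
    let ?h = "card (bottom_vars n t)"
    let ?F = "(\<Prod>(i, j)\<in>bottom_vars n t. bordered_minor t i j) :: 'k mpoly"
    define g0 where "g0 = Poly_Mapping.single (mscale (q - 1) (vsum (top_vars n t)) - m) (inverse (lookup c' m))"
    have g0: "g0 \<in> polys (sym_vars n)"
      unfolding g0_def by (intro polys_single order.trans[OF keys_vsum_minus top_vars_sym_vars]) simp
    have tr: "\<Phi> (?F ^ (q - 1) * ((corner_minor t ^ ?h * g0) * c')) = corner_minor t ^ ?h"
      unfolding g0_def using b q le_less_trans by (intro trace_bordered_minor_prod[OF t ft c'(1) m]) blast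
    have F: "?F ^ (q - 1) \<in> ipow (bordered_minors n t) (?h * (q - 1))"
      by (rule ipow_power) (rule bordered_minor_prod_ipow)
    define g where "g = ?F ^ (q - 1) * (corner_minor t ^ ?h * g0 * corner_minor t ^ M)"
    have "xvar i j \<in> (polys (sym_vars n) :: 'k mpoly set)" if "i < n" "j < n" for i j using that by (rule xvar_polys)
    then have "bordered_minor t i j \<in> (polys (sym_vars n) :: 'k mpoly set)" if "(i, j) \<in> bottom_vars n t" for i j
      unfolding bordered_minor_def using that t by (intro polys_det[of _ "Suc t"]) (auto simp: bordered_mat_def bottom_vars_def)
    then have Fp: "?F \<in> polys (sym_vars n)" by (intro polys_prod) auto
    have corner_minor: "corner_minor t \<in> (polys (sym_vars n) :: 'k mpoly set)" using t by (intro corner_minor_polys) simp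
    have gp: "g \<in> polys (sym_vars n)"
      unfolding g_def using Fp g0 corner_minor by (intro polys_mult polys_power)
    have gi: "corner_minor t ^ 0 * g \<in> ipow (bordered_minors n t) (?h * (q - 1))"
      unfolding g_def using ipow_mult_left[OF F, of "corner_minor t ^ ?h * g0 * corner_minor t ^ M"]
      by (simp only: power_0 mult_1 mult.commute[of "?F ^ (q - 1)"])
    have "u * (w * l) * x = u * (w * (l * x - y)) + u * (w * y)" for u w l x y :: "'k mpoly"
      by (simp add: algebra_simps)
    \<comment> \<open>The factor \<open>corner_minor t ^ M\<close> in \<open>g\<close> rewrites
      \<open>c\<close> as \<open>?r + c'\<close>; the trace of the first part falls into the
      kernel.\<close>
    then have e: "g * c = ?F ^ (q - 1) * ((corner_minor t ^ ?h * g0) * ?r) + ?F ^ (q - 1) * ((corner_minor t ^ ?h * g0) * c')"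
      unfolding g_def .
    have "ev t (\<Phi> (?F ^ (q - 1) * ((corner_minor t ^ ?h * g0) * ?r))) = 0"
    proof (rule trace_kernel[OF ft t])
      show "corner_minor t ^ 0 * ?F ^ (q - 1) \<in> ipow (bordered_minors n t) (?h * (q - 1))" using F by simp
      show "(corner_minor t ^ ?h * g0) * ?r \<in> polys (sym_vars n)"
        using corner_minor g0 c(1) c's by (intro polys_mult polys_diff polys_power)
      show "ev t ((corner_minor t ^ ?h * g0) * ?r) = 0" using \<open>ev t ?r = 0\<close> by (simp only: subst_mult mult_zero_right)
    qed
    then have "ev t (\<Phi> (g * c) - corner_minor t ^ ?h) = 0"
      unfolding e trace_add tr by simp
    then show "\<exists>N g. corner_minor t ^ N * g \<in> ipow (bordered_minors n t) (?h * (q - 1)) \<and> g \<in> polys (sym_vars n)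
      \<and> ev t (\<Phi> (g * c) - corner_minor t ^ ?h) = 0"
      using gp gi by blast
  qed
qed

section \<open>Composition of the two traces\<close>

lemma kernel_splitting:
  fixes c :: "'k::field mpoly"
  assumes p: "prime CHAR('k)" and t: "0 < t" "t < n" and c: "c \<in> polys (sym_vars n)" "ev t c \<noteq> 0"
  shows "\<exists>e\<ge>e0. \<exists>\<phi>. (\<forall>x y. \<phi> (x + y) = \<phi> x + \<phi> y) \<and> (\<forall>x y. \<phi> (x ^ (CHAR('k) ^ e) * y) = x * \<phi> y)
    \<and> (\<forall>x\<in>polys (sym_vars n). \<phi> x \<in> polys (sym_vars n) \<and> (ev t x = 0 \<longrightarrow> ev t (\<phi> x) = 0))
    \<and> ev t (\<phi> c) = 1"
proof -
  let ?p = "CHAR('k)" and ?h = "card (bottom_vars n t)"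
  have p1: "Suc 0 < ?p" using p by (simp add: prime_gt_Suc_0_nat)
  obtain b where b: "\<And>q e \<pi>. b < q \<Longrightarrow> frobenius_trace \<pi> q e (shift n q) \<Longrightarrow>
    (\<exists>N g. corner_minor t ^ N * g \<in> ipow (bordered_minors n t) (?h * (q - 1)) \<and> g \<in> polys (sym_vars n)
    \<and> ev t (cartier \<pi> q (shift n q) (g * c) - corner_minor t ^ ?h) = 0)"
    using split_off_kernel[OF t(2) c] by blast
  \<comment> \<open>The exponent \<open>b\<close> itself suffices, since
    \<open>b < ?p ^ b\<close>.\<close>
  define q1 where "q1 = ?p ^ b"
  have q1: "b < q1" unfolding q1_def using p1 by (rule power_gt_expt)
  obtain \<pi>1 :: "'k \<Rightarrow> 'k" where f1: "frobenius_trace \<pi>1 q1 b (shift n q1)"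
    using frobenius_trace_exists[OF p q1_def] by blast
  obtain N1 g1 where g1: "corner_minor t ^ N1 * g1 \<in> ipow (bordered_minors n t) (?h * (q1 - 1))" "g1 \<in> polys (sym_vars n)"
    "ev t (cartier \<pi>1 q1 (shift n q1) (g1 * c) - corner_minor t ^ ?h) = 0"
    using b[OF q1 f1] by blast
  \<comment> \<open>The summand \<open>e0\<close> makes the total exponent \<open>e2 + b\<close>
    large enough, and \<open>2 * ?h\<close> ensures \<open>2 * ?h \<le> q2 - 1\<close>.\<close>
  define e2 where "e2 = e0 + 2 * ?h"
  define q2 where "q2 = ?p ^ e2"
  have "e2 < q2" unfolding q2_def using p1 by (rule power_gt_expt)
  then have q2: "2 * ?h \<le> q2 - 1" by (simp add: e2_def)
  obtain \<pi>2 :: "'k \<Rightarrow> 'k" where f2: "frobenius_trace \<pi>2 q2 e2 (shift n q2)"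
    using frobenius_trace_exists[OF p q2_def] by blast
  obtain N2 g2 where g2: "corner_minor t ^ N2 * g2 \<in> ipow (bordered_minors n t) (?h * (q2 - 1))" "g2 \<in> polys (sym_vars n)"
    "ev t (cartier \<pi>2 q2 (shift n q2) (g2 * corner_minor t ^ ?h)) = 1"
    using split_corner_minor[OF t f2 q2] by blast
  interpret F1: frobenius_trace \<pi>1 q1 b "shift n q1" by (rule f1)
  interpret F2: frobenius_trace \<pi>2 q2 e2 "shift n q2" by (rule f2)
  define \<chi> where "\<chi> x = F1.\<Phi> (g1 * x)" for x
  define \<psi> where "\<psi> x = F2.\<Phi> (g2 * x)" for x
  have \<chi>_ker: "ev t (\<chi> x) = 0" and \<psi>_ker: "ev t (\<psi> x) = 0" if "x \<in> polys (sym_vars n)" "ev t x = 0" for x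
    using trace_kernel[OF f1 t(2) g1(1) that] trace_kernel[OF f2 t(2) g2(1) that] by (auto simp: \<chi>_def \<psi>_def)
  have pol: "\<chi> x \<in> polys (sym_vars n)" "\<psi> x \<in> polys (sym_vars n)" if "x \<in> polys (sym_vars n)" for x
    unfolding \<chi>_def \<psi>_def using g1(2) g2(2) that by (auto intro: F1.trace_polys F2.trace_polys polys_mult)
  have add: "\<chi> (x + y) = \<chi> x + \<chi> y" "\<psi> (x + y) = \<psi> x + \<psi> y" for x y
    by (simp_all add: \<chi>_def \<psi>_def distrib_left F1.trace_add F2.trace_add)
  have mult: "\<chi> (x ^ q1 * y) = x * \<chi> y" "\<psi> (x ^ q2 * y) = x * \<psi> y" for x y
    using F1.trace_power_mult[of x "g1 * y"] F2.trace_power_mult[of x "g2 * y"]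
    by (simp_all add: \<chi>_def \<psi>_def mult_ac)
  have "\<psi> (\<chi> (x ^ (?p ^ (e2 + b)) * y)) = x * \<psi> (\<chi> y)" for x y
  proof -
    have "x ^ (?p ^ (e2 + b)) = (x ^ q2) ^ q1" by (simp add: q1_def q2_def power_add power_mult)
    then show ?thesis by (simp add: mult)
  qed
  moreover have "ev t (\<psi> (\<chi> c)) = 1"
  proof -
    have "ev t (\<psi> (\<chi> c - corner_minor t ^ ?h)) = 0"
      using g1(3) c(1) t by (intro \<psi>_ker polys_diff pol polys_power corner_minor_polys) (auto simp: \<chi>_def)
    moreover have "\<psi> (\<chi> c) = \<psi> (\<chi> c - corner_minor t ^ ?h) + \<psi> (corner_minor t ^ ?h)" by (simp flip: add)
    ultimately show ?thesis using g2(3) by (simp add: subst_add \<psi>_def)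
  qed
  ultimately show ?thesis
    using add pol \<chi>_ker \<psi>_ker
    by (intro exI[of _ "e2 + b"] conjI exI[of _ "\<lambda>x. \<psi> (\<chi> x)"]) (auto simp: e2_def)
qed

section \<open>Tight closure\<close>

text \<open>Given \<open>c * x ^ q\<close> in the Frobenius power of \<open>I\<close>, apply a
  q-th-root-linear map sending \<open>c\<close> to 1: the result is \<open>x\<close> and lies in
  \<open>I\<close>. In a domain the zero ideal is a minimal prime, so the multipliers allowed in
  tight closure are nonzero; a single large \<open>e\<close> is enough.\<close>

lemma weakly_F_regular_domain:
  assumes "domain Q"
    and split: "\<And>c e0. c \<in> carrier Q \<Longrightarrow> c \<noteq> \<zero>\<^bsub>Q\<^esub> \<Longrightarrow> \<exists>e\<ge>e0. \<exists>\<phi>\<in>carrier Q \<rightarrow> carrier Q.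
      (\<forall>x\<in>carrier Q. \<forall>y\<in>carrier Q. \<phi> (x \<oplus>\<^bsub>Q\<^esub> y) = \<phi> x \<oplus>\<^bsub>Q\<^esub> \<phi> y) \<and>
      (\<forall>x\<in>carrier Q. \<forall>y\<in>carrier Q. \<phi> (x [^]\<^bsub>Q\<^esub> (p ^ e) \<otimes>\<^bsub>Q\<^esub> y) = x \<otimes>\<^bsub>Q\<^esub> \<phi> y) \<and> \<phi> c = \<one>\<^bsub>Q\<^esub>"
  shows "weakly_F_regular Q p"
  unfolding weakly_F_regular_def
proof (intro allI impI equalityI subsetI)
  interpret domain Q by fact
  fix I x assume "ideal I Q"
  interpret I: ideal I Q by fact
  have pow_sub: "(\<lambda>a. a [^]\<^bsub>Q\<^esub> (k::nat)) ` I \<subseteq> carrier Q" for k using I.Icarr by auto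
  show "x \<in> tight_closure Q p I" if x: "x \<in> I"
    unfolding tight_closure_def
  proof (intro CollectI conjI bexI exI allI impI)
    show "x \<in> carrier Q" using x by (rule I.Icarr)
    show "\<one>\<^bsub>Q\<^esub> \<otimes>\<^bsub>Q\<^esub> x [^]\<^bsub>Q\<^esub> (p ^ e) \<in> frob_power Q I (p ^ e)" for e
      unfolding frob_power_def using x I.Icarr[OF x] genideal_self[OF pow_sub[of "p ^ e"]] by auto
    show "\<one>\<^bsub>Q\<^esub> \<in> ring_circ Q"
      unfolding ring_circ_def minimal_prime_def
      using ideal.one_imp_carrier primeideal.axioms(1) primeideal.I_notcarr by fastforce
  qed
  show "x \<in> I" if x: "x \<in> tight_closure Q p I"
  proof -
    obtain c e0 where xc: "x \<in> carrier Q" and c: "c \<in> ring_circ Q"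
      and cx: "\<And>e. e0 \<le> e \<Longrightarrow> c \<otimes>\<^bsub>Q\<^esub> (x [^]\<^bsub>Q\<^esub> (p ^ e)) \<in> frob_power Q I (p ^ e)"
      using x by (auto simp: tight_closure_def)
    have "minimal_prime Q {\<zero>\<^bsub>Q\<^esub>}"
      unfolding minimal_prime_def
    proof (intro conjI allI impI zeroprimeideal)
      fix P assume P: "primeideal P Q \<and> P \<subseteq> {\<zero>\<^bsub>Q\<^esub>}"
      then have "\<zero>\<^bsub>Q\<^esub> \<in> P"
        using additive_subgroup.zero_closed ideal.axioms(1) primeideal.axioms(1) by blast
      then show "P = {\<zero>\<^bsub>Q\<^esub>}" using P by blast
    qed
    then have cc: "c \<in> carrier Q" "c \<noteq> \<zero>\<^bsub>Q\<^esub>" using c by (auto simp: ring_circ_def)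
    obtain e \<phi> where e: "e0 \<le> e" and maps: "\<phi> \<in> carrier Q \<rightarrow> carrier Q"
      and add: "\<And>x y. x \<in> carrier Q \<Longrightarrow> y \<in> carrier Q \<Longrightarrow> \<phi> (x \<oplus>\<^bsub>Q\<^esub> y) = \<phi> x \<oplus>\<^bsub>Q\<^esub> \<phi> y"
      and mult: "\<And>x y. x \<in> carrier Q \<Longrightarrow> y \<in> carrier Q \<Longrightarrow> \<phi> (x [^]\<^bsub>Q\<^esub> (p ^ e) \<otimes>\<^bsub>Q\<^esub> y) = x \<otimes>\<^bsub>Q\<^esub> \<phi> y"
      and one: "\<phi> c = \<one>\<^bsub>Q\<^esub>"
      using split[OF cc, of e0] by blast
    \<comment> \<open>Quantifying over all multiples \<open>r\<close> makes this an ideal. It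
      contains the q-th powers of elements of \<open>I\<close>, hence the whole Frobenius
      power.\<close>
    let ?S = "{y \<in> carrier Q. \<forall>r\<in>carrier Q. \<phi> (r \<otimes>\<^bsub>Q\<^esub> y) \<in> I}"
    have closed: "\<phi> r \<in> carrier Q" if "r \<in> carrier Q" for r using maps that by blast
    have "\<phi> \<zero>\<^bsub>Q\<^esub> \<oplus>\<^bsub>Q\<^esub> \<phi> \<zero>\<^bsub>Q\<^esub> = \<phi> \<zero>\<^bsub>Q\<^esub>" using add[of "\<zero>\<^bsub>Q\<^esub>" "\<zero>\<^bsub>Q\<^esub>"] by simp
    then have zero: "\<phi> \<zero>\<^bsub>Q\<^esub> = \<zero>\<^bsub>Q\<^esub>" using closed[of "\<zero>\<^bsub>Q\<^esub>"] by (metis add.r_cancel_one zero_closed)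
    have "ideal ?S Q"
    proof (rule idealI[OF ring_axioms])
      have mult_S: "s \<otimes>\<^bsub>Q\<^esub> y \<in> ?S" if "y \<in> ?S" "s \<in> carrier Q" for s y
        using that by (auto simp: m_assoc[symmetric])
      show "s \<otimes>\<^bsub>Q\<^esub> y \<in> ?S" "y \<otimes>\<^bsub>Q\<^esub> s \<in> ?S" if "y \<in> ?S" "s \<in> carrier Q" for s y
        using mult_S[OF that] m_comm[of s y] that by auto
      show "subgroup ?S (add_monoid Q)"
      proof (rule add.subgroupI)
        fix y assume y: "y \<in> ?S"
        then have "\<ominus>\<^bsub>Q\<^esub> y = (\<ominus>\<^bsub>Q\<^esub> \<one>\<^bsub>Q\<^esub>) \<otimes>\<^bsub>Q\<^esub> y" by (simp add: l_minus)
        then show "\<ominus>\<^bsub>Q\<^esub> y \<in> ?S" using mult_S[OF y, of "\<ominus>\<^bsub>Q\<^esub> \<one>\<^bsub>Q\<^esub>"] by simp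
      next
        fix y z assume "y \<in> ?S" "z \<in> ?S"
        then show "y \<oplus>\<^bsub>Q\<^esub> z \<in> ?S" by (auto simp: r_distr add)
      qed (use zero in auto)
    qed
    moreover have "(\<lambda>a. a [^]\<^bsub>Q\<^esub> (p ^ e)) ` I \<subseteq> ?S"
    proof safe
      fix a assume a: "a \<in> I"
      then show "a [^]\<^bsub>Q\<^esub> (p ^ e) \<in> carrier Q" using I.Icarr by auto
      fix r assume r: "r \<in> carrier Q"
      have "\<phi> (r \<otimes>\<^bsub>Q\<^esub> a [^]\<^bsub>Q\<^esub> (p ^ e)) = a \<otimes>\<^bsub>Q\<^esub> \<phi> r"
        using mult[OF I.Icarr[OF a] r] r I.Icarr[OF a] by (simp add: m_comm)
      then show "\<phi> (r \<otimes>\<^bsub>Q\<^esub> a [^]\<^bsub>Q\<^esub> (p ^ e)) \<in> I" using a closed[OF r] by (simp add: I.I_r_closed)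
    qed
    ultimately have "frob_power Q I (p ^ e) \<subseteq> ?S"
      unfolding frob_power_def by (rule genideal_minimal)
    then have "\<phi> (\<one>\<^bsub>Q\<^esub> \<otimes>\<^bsub>Q\<^esub> (c \<otimes>\<^bsub>Q\<^esub> (x [^]\<^bsub>Q\<^esub> (p ^ e)))) \<in> I" using cx[OF e] by blast
    also have "\<one>\<^bsub>Q\<^esub> \<otimes>\<^bsub>Q\<^esub> (c \<otimes>\<^bsub>Q\<^esub> (x [^]\<^bsub>Q\<^esub> (p ^ e))) = x [^]\<^bsub>Q\<^esub> (p ^ e) \<otimes>\<^bsub>Q\<^esub> c"
      using xc cc by (simp add: m_comm)
    also have "\<phi> \<dots> = x" using mult[OF xc cc(1)] one xc by simp
    finally show ?thesis .
  qed
qed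

lemma minus_sym_poly_ring:
  assumes "x \<in> polys (sym_vars n)" "y \<in> polys (sym_vars n)"
  shows "x \<ominus>\<^bsub>sym_poly_ring n\<^esub> y = (x - y :: 'k::comm_ring_1 mpoly)"
proof -
  interpret cring "sym_poly_ring n :: 'k mpoly ring" by (rule cring_sym_poly_ring)
  have "\<ominus>\<^bsub>sym_poly_ring n\<^esub> y = - y"
    using assms by (intro sum_zero_eq_neg[symmetric]) (auto simp: carrier_sym_poly_ring polys_uminus)
  then show ?thesis by (simp add: a_minus_def)
qed

text \<open>The ideal is the kernel of a homomorphism to a domain.\<close>

lemma det_ideal_prime: "primeideal (det_ideal n (Suc t) :: 'k::idom mpoly set) (sym_poly_ring n)"
proof (rule primeidealI[OF det_ideal_ideal cring_sym_poly_ring])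
  have "(1 :: 'k mpoly) \<notin> det_ideal n (Suc t)" by (simp add: det_ideal_eq)
  then show "carrier (sym_poly_ring n) \<noteq> (det_ideal n (Suc t) :: 'k mpoly set)"
    using polys_1[of "sym_vars n"] unfolding carrier_sym_poly_ring by blast
qed (auto simp: det_ideal_eq carrier_sym_poly_ring subst_mult)

theorem theorem2p2:
  fixes n t :: nat
  assumes "prime CHAR('k::field)"
    and "0 < t" and "t + 1 \<le> n"
  shows "weakly_F_regular
           ((sym_poly_ring n :: 'k mpoly ring) Quot (det_ideal n (t + 1) :: 'k mpoly set))
           CHAR('k)"
proof -
  let ?R = "sym_poly_ring n :: 'k mpoly ring"
  let ?I = "det_ideal n (Suc t) :: 'k mpoly set"
  let ?p = "CHAR('k)"
  interpret R: cring ?R by (rule cring_sym_poly_ring)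
  interpret I: primeideal ?I ?R by (rule det_ideal_prime)
  interpret Q: domain "?R Quot ?I" by (rule I.quotient_is_domain)
  interpret h: ring_hom_cring ?R "?R Quot ?I" "(+>\<^bsub>?R\<^esub>) ?I"
    by (rule I.rcos_ring_hom_cring)
  have eq_iff: "?I +>\<^bsub>?R\<^esub> x = ?I +>\<^bsub>?R\<^esub> y \<longleftrightarrow> ev t (x - y) = 0"
    if "x \<in> carrier ?R" "y \<in> carrier ?R" for x y
    using R.quotient_eq_iff_same_a_r_cos[OF I.is_ideal that] that
    by (simp add: carrier_sym_poly_ring minus_sym_poly_ring det_ideal_eq polys_diff)
  have carrier: "\<exists>x\<in>carrier ?R. X = ?I +>\<^bsub>?R\<^esub> x" if "X \<in> carrier (?R Quot ?I)" for X
    using that by (auto simp: FactRing_def A_RCOSETS_def')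
  have "weakly_F_regular (?R Quot ?I) ?p"
  proof (rule weakly_F_regular_domain)
    show "domain (?R Quot ?I)" ..
    fix C e0 assume C: "C \<in> carrier (?R Quot ?I)" "C \<noteq> \<zero>\<^bsub>?R Quot ?I\<^esub>"
    obtain c where c: "c \<in> carrier ?R" "C = ?I +>\<^bsub>?R\<^esub> c" using carrier[OF C(1)] by blast
    have "ev t c \<noteq> 0"
      using C(2) eq_iff[OF c(1) R.zero_closed] h.hom_zero unfolding c(2) by auto
    then obtain e \<phi> where e: "e0 \<le> e" and \<phi>: "\<forall>x y. \<phi> (x + y) = \<phi> x + \<phi> y"
      "\<forall>x y. \<phi> (x ^ (?p ^ e) * y) = x * \<phi> y"
      "\<forall>x\<in>carrier ?R. \<phi> x \<in> carrier ?R \<and> (ev t x = 0 \<longrightarrow> ev t (\<phi> x) = 0)" "ev t (\<phi> c) = 1"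
      using kernel_splitting[OF assms(1,2), of n c e0] assms(3) c(1) unfolding carrier_sym_poly_ring by auto
    have add: "\<phi> (x + y) = \<phi> x + \<phi> y" and mult: "\<phi> (x ^ (?p ^ e) * y) = x * \<phi> y" for x y
      using \<phi>(1,2) by blast+
    have maps: "\<phi> x \<in> carrier ?R" and ker: "ev t x = 0 \<Longrightarrow> ev t (\<phi> x) = 0" if "x \<in> carrier ?R" for x
      using \<phi>(3) that by blast+
    note one = \<phi>(4)
    \<comment> \<open>The map on cosets is defined through a chosen representative; it is
      independent of the choice because \<open>\<phi>\<close> is additive and preserves the kernel
      of \<open>ev t\<close>.\<close>
    define \<psi> where "\<psi> X = ?I +>\<^bsub>?R\<^esub> \<phi> (SOME x. x \<in> carrier ?R \<and> X = ?I +>\<^bsub>?R\<^esub> x)" for X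
    have \<psi>: "\<psi> (?I +>\<^bsub>?R\<^esub> x) = ?I +>\<^bsub>?R\<^esub> \<phi> x" if x: "x \<in> carrier ?R" for x
    proof -
      define y where "y = (SOME y. y \<in> carrier ?R \<and> ?I +>\<^bsub>?R\<^esub> x = ?I +>\<^bsub>?R\<^esub> y)"
      have y: "y \<in> carrier ?R" "?I +>\<^bsub>?R\<^esub> x = ?I +>\<^bsub>?R\<^esub> y"
        using someI[of "\<lambda>y. y \<in> carrier ?R \<and> ?I +>\<^bsub>?R\<^esub> x = ?I +>\<^bsub>?R\<^esub> y" x] x by (auto simp: y_def)
      have "ev t (\<phi> (y - x)) = 0"
        using eq_iff[OF y(1) x] y x by (intro ker) (auto simp: carrier_sym_poly_ring polys_diff)
      moreover have "\<phi> y = \<phi> (y - x) + \<phi> x" by (simp flip: add)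
      ultimately have "?I +>\<^bsub>?R\<^esub> \<phi> y = ?I +>\<^bsub>?R\<^esub> \<phi> x"
        using eq_iff[OF maps[OF y(1)] maps[OF x]] by simp
      then show ?thesis by (simp add: \<psi>_def y_def)
    qed
    show "\<exists>e\<ge>e0. \<exists>\<phi>\<in>carrier (?R Quot ?I) \<rightarrow> carrier (?R Quot ?I).
      (\<forall>x\<in>carrier (?R Quot ?I). \<forall>y\<in>carrier (?R Quot ?I). \<phi> (x \<oplus>\<^bsub>?R Quot ?I\<^esub> y) = \<phi> x \<oplus>\<^bsub>?R Quot ?I\<^esub> \<phi> y) \<and>
      (\<forall>x\<in>carrier (?R Quot ?I). \<forall>y\<in>carrier (?R Quot ?I).
        \<phi> (x [^]\<^bsub>?R Quot ?I\<^esub> (?p ^ e) \<otimes>\<^bsub>?R Quot ?I\<^esub> y) = x \<otimes>\<^bsub>?R Quot ?I\<^esub> \<phi> y) \<and> \<phi> C = \<one>\<^bsub>?R Quot ?I\<^esub>"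
    proof (intro exI[of _ e] conjI bexI[of _ \<psi>] e ballI)
      fix X Y assume "X \<in> carrier (?R Quot ?I)" "Y \<in> carrier (?R Quot ?I)"
      then obtain x y where x: "x \<in> carrier ?R" "X = ?I +>\<^bsub>?R\<^esub> x" and y: "y \<in> carrier ?R" "Y = ?I +>\<^bsub>?R\<^esub> y"
        using carrier by meson
      have xy: "X \<oplus>\<^bsub>?R Quot ?I\<^esub> Y = ?I +>\<^bsub>?R\<^esub> (x \<oplus>\<^bsub>?R\<^esub> y)"
        unfolding x(2) y(2) by (rule h.hom_add[OF x(1) y(1), symmetric])
      have pxy: "X [^]\<^bsub>?R Quot ?I\<^esub> (?p ^ e) \<otimes>\<^bsub>?R Quot ?I\<^esub> Y = ?I +>\<^bsub>?R\<^esub> (x [^]\<^bsub>?R\<^esub> (?p ^ e) \<otimes>\<^bsub>?R\<^esub> y)"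
        unfolding x(2) y(2) using x(1) y(1) by (simp only: h.hom_mult ring_hom_ring.hom_nat_pow[OF I.rcos_ring_hom_ring] R.nat_pow_closed)
      show "\<psi> (X \<oplus>\<^bsub>?R Quot ?I\<^esub> Y) = \<psi> X \<oplus>\<^bsub>?R Quot ?I\<^esub> \<psi> Y"
        unfolding xy \<psi>[OF R.a_closed[OF x(1) y(1)]]
        unfolding x(2) y(2) \<psi>[OF x(1)] \<psi>[OF y(1)] h.hom_add[OF maps[OF x(1)] maps[OF y(1)], symmetric]
        by (simp add: add)
      show "\<psi> (X [^]\<^bsub>?R Quot ?I\<^esub> (?p ^ e) \<otimes>\<^bsub>?R Quot ?I\<^esub> Y) = X \<otimes>\<^bsub>?R Quot ?I\<^esub> \<psi> Y"
        unfolding pxy \<psi>[OF R.m_closed[OF R.nat_pow_closed[OF x(1)] y(1)]]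
        unfolding x(2) y(2) \<psi>[OF y(1)] h.hom_mult[OF x(1) maps[OF y(1)], symmetric]
        by (simp add: mult nat_pow_sym_poly_ring)
    next
      have "?I +>\<^bsub>?R\<^esub> \<phi> c = ?I +>\<^bsub>?R\<^esub> \<one>\<^bsub>?R\<^esub>"
        using eq_iff[OF maps[OF c(1)] R.one_closed] one by (simp add: subst.hom_minus)
      then show "\<psi> C = \<one>\<^bsub>?R Quot ?I\<^esub>"
        unfolding c(2) \<psi>[OF c(1)] using h.hom_one by simp
      show "\<psi> \<in> carrier (?R Quot ?I) \<rightarrow> carrier (?R Quot ?I)"
      proof
        fix X assume "X \<in> carrier (?R Quot ?I)"
        then obtain x where "x \<in> carrier ?R" "X = ?I +>\<^bsub>?R\<^esub> x" using carrier by meson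
        then show "\<psi> X \<in> carrier (?R Quot ?I)" using \<psi> maps by simp
      qed
    qed
  qed
  then show ?thesis by simp
qed

end
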